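(* Let $(L,\alpha)$ be a Hom-Lie-Yamaguti superalgebra over $\mathbb{K}$ with $H^2(L,L)\times H^3(L,L)=0$. Then $L$ is analytically rigid, i.e. every 1-parameter formal deformation $(f_t,g_t)$ of $L$ is equivalent to the null deformation $(f_0,g_0)=([\cdot,\cdot],\{\cdot,\cdot,\cdot\})$.
   Context: $\mathbb{K}$ is an algebraically closed field of characteristic different from $2$ and $3$. $|x|\in\mathbb{Z}_2$ denotes the degree of a homogeneous element; identities are for homogeneous elements. $\circlearrowleft_{(x,y,z)}$ denotes the sum over cyclic permutations of $x,y,z$ (the sign prefactor is permuted too). A Hom-Lie-Yamaguti superalgebra $(L,[\cdot,\cdot],\{\cdot,\cdot,\cdot\},\alpha)$, denoted $(L,\alpha)$, is a $\mathbb{K}$-vector superspace $L$ with an even bilinear operation $[\cdot,\cdot]$, an even trilinear operation $\{\cdot,\cdot,\cdot\}$, and an even linear map $\alpha:L\to L$ such that for all homogeneous $x,y,z,u,v,w\in L$: - $\alpha([x,y])=[\alpha(x),\alpha(y)]$; - $\alpha(\{x,y,z\})=\{\alpha(x),\alpha(y),\alpha(z)\}$; - $[x,y]=-(-1)^{|x||y|}[y,x]$; - $\{x,y,z\}=-(-1)^{|x||y|}\{y,x,z\}$; - $\circlearrowleft_{(x,y,z)}(-1)^{|x||z|}([[x,y],\alpha(z)]+\{x,y,z\})=0$; - $\circlearrowleft_{(x,y,z)}(-1)^{|x||z|}\{[x,y],\alpha(z),\alpha(u)\}=0$; - $\{\alpha(x),\alpha(y),[u,v]\}=[\{x,y,u\},\alpha^2(v)]+(-1)^{|u|(|x|+|y|)}[\alpha^2(u),\{x,y,v\}]$;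 - $\{\alpha^2(x),\alpha^2(y),\{u,v,w\}\}=\{\{x,y,u\},\alpha^2(v),\alpha^2(w)\}+(-1)^{|u|(|x|+|y|)}\{\alpha^2(u),\{x,y,v\},\alpha^2(w)\}+(-1)^{(|u|+|v|)(|x|+|y|)}\{\alpha^2(u),\alpha^2(v),\{x,y,w\}\}$. The same definition is used over $\mathbb{K}[[t]]$ ($t$ even). Deformations. $L[[t]]$ is the $\mathbb{K}[[t]]$-module of formal power series with coefficients in $L$; maps on $L$ are extended $\mathbb{K}[[t]]$-(multi)linearly. A 1-parameter formal deformation of $L$ is a pair $f_t=\sum_{i\ge0}f_it^i$, $g_t=\sum_{i\ge0}g_it^i$ with $f_0=[\cdot,\cdot]$, $g_0=\{\cdot,\cdot,\cdot\}$, each $f_i:L\times L\to L$ even $\mathbb{K}$-bilinear and each $g_i:L\times L\times L\to L$ even $\mathbb{K}$-trilinear, such that $(L[[t]],f_t,g_t,\alpha)$ is a Hom-Lie-Yamaguti superalgebra over $\mathbb{K}[[t]]$. Two deformations $(f_t,g_t)$, $(f'_t,g'_t)$ are equivalent if there is a formal isomorphism of $\mathbb{K}[[t]]$-modules $\phi_t=\sum_{i\ge0}\phi_it^i:L[[t]]\to L[[t]]$ with $\phi_i:L\to L$ even $\mathbb{K}$-linear, $\phi_0=\mathrm{id}_L$, $\phi_t\circ\alpha=\alpha\circ\phi_t$, $\phi_t(f_t(x,y))=f'_t(\phi_t(x),\phi_t(y))$ and $\phi_t(g_t(x,y,z))=g'_t(\phi_t(x),\phi_t(y),\phi_t(z))$.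 Cohomology. $C^1(L,L)$: even linear $h:L\to L$ with $h\alpha=\alpha h$. $C^2(L,L)$: even bilinear $f:L\times L\to L$ with $f(x,y)=-(-1)^{|x||y|}f(y,x)$ and $\alpha(f(x,y))=f(\alpha(x),\alpha(y))$. $C^3(L,L)$: even trilinear $g$ with $g(x,y,z)=-(-1)^{|x||y|}g(y,x,z)$ and $\alpha(g(x,y,z))=g(\alpha(x),\alpha(y),\alpha(z))$. $Z^2(L,L)\times Z^3(L,L)$ denotes the space of pairs $(f,g)\in C^2(L,L)\times C^3(L,L)$ such that for all homogeneous $x,y,z,u,v,w$: - $\circlearrowleft_{(x,y,z)}(-1)^{|x||z|}\big([f(x,y),\alpha(z)]+f([x,y],\alpha(z))+g(x,y,z)\big)=0$; - $\circlearrowleft_{(x,y,z)}(-1)^{|x||z|}\big(\{f(x,y),\alpha(z),\alpha(u)\}+g([x,y],\alpha(z),\alpha(u))\big)=0$; - $\{\alpha(x),\alpha(y),f(u,v)\}+g(\alpha(x),\alpha(y),[u,v])=[g(x,y,u),\alpha^2(v)]+f(\{x,y,u\},\alpha^2(v))+(-1)^{|u|(|x|+|y|)}\big([\alpha^2(u),g(x,y,v)]+f(\alpha^2(u),\{x,y,v\})\big)$; - $\{\alpha^2(x),\alpha^2(y),g(u,v,w)\}+g(\alpha^2(x),\alpha^2(y),\{u,v,w\})=\{g(x,y,u),\alpha^2(v),\alpha^2(w)\}+g(\{x,y,u\},\alpha^2(v),\alpha^2(w))+(-1)^{|u|(|x|+|y|)}\big(\{\alpha^2(u),g(x,y,v),\alpha^2(w)\}+g(\alpha^2(u),\{x,y,v\},\alpha^2(w))\big)+(-1)^{(|u|+|v|)(|x|+|y|)}\big(\{\alpha^2(u),\alpha^2(v),g(x,y,w)\}+g(\alpha^2(u),\alpha^2(v),\{x,y,w\})\big)$.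 For $h\in C^1(L,L)$ put $\delta_I h(x,y)=[h(x),y]+[x,h(y)]-h([x,y])$ and $\delta_{II}h(x,y,z)=\{h(x),y,z\}+\{x,h(y),z\}+\{x,y,h(z)\}-h(\{x,y,z\})$. $B^2(L,L)\times B^3(L,L)$ denotes the space $\{(\delta_Ih,\delta_{II}h):h\in C^1(L,L)\}$, and $H^2(L,L)\times H^3(L,L):=(Z^2(L,L)\times Z^3(L,L))/(B^2(L,L)\times B^3(L,L))$ (single symbols for spaces of pairs, not Cartesian products of separately defined spaces). *)

theory Defs
  imports
    "HOL-Library.Z2"
    "HOL-Library.Function_Algebras"
    "HOL-Library.Product_Plus"
    "HOL-Computational_Algebra.Polynomial"
    "HOL-Computational_Algebra.Formal_Power_Series"
begin

section \<open>Superspaces and even multilinear maps\<close>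

text \<open>
  Everything in this and the next section is over a commutative ring with unit, so that it can be
  used both over a field (where a module is a vector space) and over formal power series.
  A grading is a function \<open>L\<close> from the degrees (the type \<^typ>\<open>bit\<close>, i.e. \<open>Z/2\<close>) to
  submodules of the ambient type. Homogeneity of \<open>x\<close> of degree \<open>a\<close> is \<open>x \<in> L a\<close>, and
  "for all homogeneous elements" is rendered by quantifying over the degrees as well.
\<close>

locale superspace = module scale
  for scale :: "'r::comm_ring_1 \<Rightarrow> 'v::ab_group_add \<Rightarrow> 'v"  (infixr \<open>*s\<close> 75) +
  fixes L :: "bit \<Rightarrow> 'v set"
  assumes subspace_grading: "module.subspace scale (L a)"
    and grading_Int: "L 0 \<inter> L 1 = {0}"
    and grading_sum: "\<exists>x\<in>L 0. \<exists>y\<in>L 1. v = x + y"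

definition even_linear ::
  "('r::comm_ring_1 \<Rightarrow> 'v::ab_group_add \<Rightarrow> 'v) \<Rightarrow> (bit \<Rightarrow> 'v set) \<Rightarrow> ('v \<Rightarrow> 'v) \<Rightarrow> bool"
  where "even_linear scale L h \<longleftrightarrow>
    module_hom scale scale h \<and> (\<forall>a. \<forall>x\<in>L a. h x \<in> L a)"

definition even_bilinear ::
  "('r::comm_ring_1 \<Rightarrow> 'v::ab_group_add \<Rightarrow> 'v) \<Rightarrow> (bit \<Rightarrow> 'v set) \<Rightarrow> ('v \<Rightarrow> 'v \<Rightarrow> 'v) \<Rightarrow> bool"
  where "even_bilinear scale L f \<longleftrightarrow>
    (\<forall>y. module_hom scale scale (\<lambda>x. f x y)) \<and>
    (\<forall>x. module_hom scale scale (\<lambda>y. f x y)) \<and>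
    (\<forall>a b. \<forall>x\<in>L a. \<forall>y\<in>L b. f x y \<in> L (a + b))"

definition even_trilinear ::
  "('r::comm_ring_1 \<Rightarrow> 'v::ab_group_add \<Rightarrow> 'v) \<Rightarrow> (bit \<Rightarrow> 'v set)
    \<Rightarrow> ('v \<Rightarrow> 'v \<Rightarrow> 'v \<Rightarrow> 'v) \<Rightarrow> bool"
  where "even_trilinear scale L g \<longleftrightarrow>
    (\<forall>y z. module_hom scale scale (\<lambda>x. g x y z)) \<and>
    (\<forall>x z. module_hom scale scale (\<lambda>y. g x y z)) \<and>
    (\<forall>x y. module_hom scale scale (\<lambda>z. g x y z)) \<and>
    (\<forall>a b c. \<forall>x\<in>L a. \<forall>y\<in>L b. \<forall>z\<in>L c. g x y z \<in> L (a + b + c))"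

text \<open>\<open>sgn_pow e v\<close> is \<open>(-1)^e v\<close>, where the exponent is computed in \<open>Z/2\<close>.\<close>

definition sgn_pow :: "bit \<Rightarrow> 'v::ab_group_add \<Rightarrow> 'v"
  where "sgn_pow e v = (if e = 0 then v else - v)"

text \<open>
  The sum of \<open>(-1)^(|x||z|) F x y z\<close> over the cyclic permutations of \<open>x, y, z\<close>, where \<open>a, b, c\<close>
  are the degrees of \<open>x, y, z\<close>; they are permuted together with the elements.
\<close>

definition cyclic_sum ::
  "('v \<Rightarrow> 'v \<Rightarrow> 'v \<Rightarrow> 'v::ab_group_add) \<Rightarrow> bit \<Rightarrow> bit \<Rightarrow> bit \<Rightarrow> 'v \<Rightarrow> 'v \<Rightarrow> 'v \<Rightarrow> 'v"
  where "cyclic_sum F a b c x y z =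
    sgn_pow (a * c) (F x y z) + sgn_pow (b * a) (F y z x) + sgn_pow (c * b) (F z x y)"


section \<open>Hom-Lie-Yamaguti superalgebras\<close>

locale hom_lie_yamaguti_superalgebra = superspace scale L
  for scale :: "'r::comm_ring_1 \<Rightarrow> 'v::ab_group_add \<Rightarrow> 'v"  (infixr \<open>*s\<close> 75)
    and L :: "bit \<Rightarrow> 'v set" +
  fixes br :: "'v \<Rightarrow> 'v \<Rightarrow> 'v"
    and tr :: "'v \<Rightarrow> 'v \<Rightarrow> 'v \<Rightarrow> 'v"
    and \<alpha> :: "'v \<Rightarrow> 'v"
  assumes even_br: "even_bilinear scale L br"
    and even_tr: "even_trilinear scale L tr"
    and even_\<alpha>: "even_linear scale L \<alpha>"
    and \<alpha>_br: "\<lbrakk>x \<in> L a; y \<in> L b\<rbrakk> \<Longrightarrow> \<alpha> (br x y) = br (\<alpha> x) (\<alpha> y)"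
    and \<alpha>_tr: "\<lbrakk>x \<in> L a; y \<in> L b; z \<in> L c\<rbrakk> \<Longrightarrow> \<alpha> (tr x y z) = tr (\<alpha> x) (\<alpha> y) (\<alpha> z)"
    and br_skew: "\<lbrakk>x \<in> L a; y \<in> L b\<rbrakk> \<Longrightarrow> br x y = - sgn_pow (a * b) (br y x)"
    and tr_skew: "\<lbrakk>x \<in> L a; y \<in> L b; z \<in> L c\<rbrakk> \<Longrightarrow> tr x y z = - sgn_pow (a * b) (tr y x z)"
    and cyclic_br: "\<lbrakk>x \<in> L a; y \<in> L b; z \<in> L c\<rbrakk> \<Longrightarrow>
      cyclic_sum (\<lambda>x y z. br (br x y) (\<alpha> z) + tr x y z) a b c x y z = 0"
    and cyclic_tr: "\<lbrakk>x \<in> L a; y \<in> L b; z \<in> L c; u \<in> L d\<rbrakk> \<Longrightarrow>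
      cyclic_sum (\<lambda>x y z. tr (br x y) (\<alpha> z) (\<alpha> u)) a b c x y z = 0"
    and tr_br: "\<lbrakk>x \<in> L a; y \<in> L b; u \<in> L c; v \<in> L d\<rbrakk> \<Longrightarrow>
      tr (\<alpha> x) (\<alpha> y) (br u v) =
        br (tr x y u) (\<alpha> (\<alpha> v)) + sgn_pow (c * (a + b)) (br (\<alpha> (\<alpha> u)) (tr x y v))"
    and tr_tr: "\<lbrakk>x \<in> L a; y \<in> L b; u \<in> L c; v \<in> L d; w \<in> L e\<rbrakk> \<Longrightarrow>
      tr (\<alpha> (\<alpha> x)) (\<alpha> (\<alpha> y)) (tr u v w) =
        tr (tr x y u) (\<alpha> (\<alpha> v)) (\<alpha> (\<alpha> w))
        + sgn_pow (c * (a + b)) (tr (\<alpha> (\<alpha> u)) (tr x y v) (\<alpha> (\<alpha> w)))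
        + sgn_pow ((c + d) * (a + b)) (tr (\<alpha> (\<alpha> u)) (\<alpha> (\<alpha> v)) (tr x y w))"


section \<open>Cohomology\<close>

definition C1 ::
  "('r::comm_ring_1 \<Rightarrow> 'v::ab_group_add \<Rightarrow> 'v) \<Rightarrow> (bit \<Rightarrow> 'v set) \<Rightarrow> ('v \<Rightarrow> 'v) \<Rightarrow> ('v \<Rightarrow> 'v) set"
  where "C1 scale L \<alpha> = {h. even_linear scale L h \<and> (\<forall>x. h (\<alpha> x) = \<alpha> (h x))}"

definition C2 ::
  "('r::comm_ring_1 \<Rightarrow> 'v::ab_group_add \<Rightarrow> 'v) \<Rightarrow> (bit \<Rightarrow> 'v set) \<Rightarrow> ('v \<Rightarrow> 'v)
    \<Rightarrow> ('v \<Rightarrow> 'v \<Rightarrow> 'v) set"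
  where "C2 scale L \<alpha> = {f. even_bilinear scale L f
    \<and> (\<forall>a b. \<forall>x\<in>L a. \<forall>y\<in>L b. f x y = - sgn_pow (a * b) (f y x))
    \<and> (\<forall>a b. \<forall>x\<in>L a. \<forall>y\<in>L b. \<alpha> (f x y) = f (\<alpha> x) (\<alpha> y))}"

definition C3 ::
  "('r::comm_ring_1 \<Rightarrow> 'v::ab_group_add \<Rightarrow> 'v) \<Rightarrow> (bit \<Rightarrow> 'v set) \<Rightarrow> ('v \<Rightarrow> 'v)
    \<Rightarrow> ('v \<Rightarrow> 'v \<Rightarrow> 'v \<Rightarrow> 'v) set"
  where "C3 scale L \<alpha> = {g. even_trilinear scale L g
    \<and> (\<forall>a b c. \<forall>x\<in>L a. \<forall>y\<in>L b. \<forall>z\<in>L c. g x y z = - sgn_pow (a * b) (g y x z))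
    \<and> (\<forall>a b c. \<forall>x\<in>L a. \<forall>y\<in>L b. \<forall>z\<in>L c. \<alpha> (g x y z) = g (\<alpha> x) (\<alpha> y) (\<alpha> z))}"

text \<open>
  \<open>Z23\<close>, \<open>B23\<close> and \<open>H23\<close> are the spaces of pairs written \<open>Z\<^sup>2 \<times> Z\<^sup>3\<close>, \<open>B\<^sup>2 \<times> B\<^sup>3\<close> and
  \<open>H\<^sup>2 \<times> H\<^sup>3\<close>; none of them is a Cartesian product.
\<close>

definition Z23 ::
  "('r::comm_ring_1 \<Rightarrow> 'v::ab_group_add \<Rightarrow> 'v) \<Rightarrow> (bit \<Rightarrow> 'v set)
    \<Rightarrow> ('v \<Rightarrow> 'v \<Rightarrow> 'v) \<Rightarrow> ('v \<Rightarrow> 'v \<Rightarrow> 'v \<Rightarrow> 'v) \<Rightarrow> ('v \<Rightarrow> 'v)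
    \<Rightarrow> (('v \<Rightarrow> 'v \<Rightarrow> 'v) \<times> ('v \<Rightarrow> 'v \<Rightarrow> 'v \<Rightarrow> 'v)) set"
  where "Z23 scale L br tr \<alpha> = {(f, g). f \<in> C2 scale L \<alpha> \<and> g \<in> C3 scale L \<alpha>
    \<and> (\<forall>a b c. \<forall>x\<in>L a. \<forall>y\<in>L b. \<forall>z\<in>L c.
        cyclic_sum (\<lambda>x y z. br (f x y) (\<alpha> z) + f (br x y) (\<alpha> z) + g x y z) a b c x y z = 0)
    \<and> (\<forall>a b c d. \<forall>x\<in>L a. \<forall>y\<in>L b. \<forall>z\<in>L c. \<forall>u\<in>L d.
        cyclic_sum (\<lambda>x y z. tr (f x y) (\<alpha> z) (\<alpha> u) + g (br x y) (\<alpha> z) (\<alpha> u)) a b c x y z = 0)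
    \<and> (\<forall>a b c d. \<forall>x\<in>L a. \<forall>y\<in>L b. \<forall>u\<in>L c. \<forall>v\<in>L d.
        tr (\<alpha> x) (\<alpha> y) (f u v) + g (\<alpha> x) (\<alpha> y) (br u v) =
          br (g x y u) (\<alpha> (\<alpha> v)) + f (tr x y u) (\<alpha> (\<alpha> v))
          + sgn_pow (c * (a + b)) (br (\<alpha> (\<alpha> u)) (g x y v) + f (\<alpha> (\<alpha> u)) (tr x y v)))
    \<and> (\<forall>a b c d e. \<forall>x\<in>L a. \<forall>y\<in>L b. \<forall>u\<in>L c. \<forall>v\<in>L d. \<forall>w\<in>L e.
        tr (\<alpha> (\<alpha> x)) (\<alpha> (\<alpha> y)) (g u v w) + g (\<alpha> (\<alpha> x)) (\<alpha> (\<alpha> y)) (tr u v w) =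
          tr (g x y u) (\<alpha> (\<alpha> v)) (\<alpha> (\<alpha> w)) + g (tr x y u) (\<alpha> (\<alpha> v)) (\<alpha> (\<alpha> w))
          + sgn_pow (c * (a + b))
              (tr (\<alpha> (\<alpha> u)) (g x y v) (\<alpha> (\<alpha> w)) + g (\<alpha> (\<alpha> u)) (tr x y v) (\<alpha> (\<alpha> w)))
          + sgn_pow ((c + d) * (a + b))
              (tr (\<alpha> (\<alpha> u)) (\<alpha> (\<alpha> v)) (g x y w) + g (\<alpha> (\<alpha> u)) (\<alpha> (\<alpha> v)) (tr x y w)))}"

definition \<delta>\<^sub>I :: "('v \<Rightarrow> 'v \<Rightarrow> 'v) \<Rightarrow> ('v \<Rightarrow> 'v) \<Rightarrow> 'v \<Rightarrow> 'v \<Rightarrow> 'v::ab_group_add"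
  where "\<delta>\<^sub>I br h x y = br (h x) y + br x (h y) - h (br x y)"

definition \<delta>\<^sub>I\<^sub>I ::
  "('v \<Rightarrow> 'v \<Rightarrow> 'v \<Rightarrow> 'v) \<Rightarrow> ('v \<Rightarrow> 'v) \<Rightarrow> 'v \<Rightarrow> 'v \<Rightarrow> 'v \<Rightarrow> 'v::ab_group_add"
  where "\<delta>\<^sub>I\<^sub>I tr h x y z = tr (h x) y z + tr x (h y) z + tr x y (h z) - h (tr x y z)"

definition B23 ::
  "('r::comm_ring_1 \<Rightarrow> 'v::ab_group_add \<Rightarrow> 'v) \<Rightarrow> (bit \<Rightarrow> 'v set)
    \<Rightarrow> ('v \<Rightarrow> 'v \<Rightarrow> 'v) \<Rightarrow> ('v \<Rightarrow> 'v \<Rightarrow> 'v \<Rightarrow> 'v) \<Rightarrow> ('v \<Rightarrow> 'v)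
    \<Rightarrow> (('v \<Rightarrow> 'v \<Rightarrow> 'v) \<times> ('v \<Rightarrow> 'v \<Rightarrow> 'v \<Rightarrow> 'v)) set"
  where "B23 scale L br tr \<alpha> = {(\<delta>\<^sub>I br h, \<delta>\<^sub>I\<^sub>I tr h) | h. h \<in> C1 scale L \<alpha>}"

text \<open>
  The quotient of \<open>Z23\<close> by \<open>B23\<close>, as the set of cosets \<open>p + B23\<close> (addition of pairs of maps is
  pointwise). Its zero element is the coset \<open>0 + B23 = B23\<close>, so the quotient is the zero space
  iff it is equal to \<open>{B23}\<close>.
\<close>

definition H23 ::
  "('r::comm_ring_1 \<Rightarrow> 'v::ab_group_add \<Rightarrow> 'v) \<Rightarrow> (bit \<Rightarrow> 'v set)
    \<Rightarrow> ('v \<Rightarrow> 'v \<Rightarrow> 'v) \<Rightarrow> ('v \<Rightarrow> 'v \<Rightarrow> 'v \<Rightarrow> 'v) \<Rightarrow> ('v \<Rightarrow> 'v)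
    \<Rightarrow> (('v \<Rightarrow> 'v \<Rightarrow> 'v) \<times> ('v \<Rightarrow> 'v \<Rightarrow> 'v \<Rightarrow> 'v)) set set"
  where "H23 scale L br tr \<alpha> = (\<lambda>p. (\<lambda>q. p + q) ` B23 scale L br tr \<alpha>) ` Z23 scale L br tr \<alpha>"


section \<open>Formal power series with coefficients in a superspace\<close>

unbundle fps_syntax

text \<open>
  \<open>L[[t]]\<close> is the type \<^typ>\<open>'v fps\<close>, with the action of \<open>K[[t]]\<close> by Cauchy products; since \<open>t\<close> is
  even, a series is homogeneous of degree \<open>a\<close> iff all its coefficients are.
\<close>

definition fps_scale ::
  "('k::comm_ring_1 \<Rightarrow> 'v::ab_group_add \<Rightarrow> 'v) \<Rightarrow> 'k fps \<Rightarrow> 'v fps \<Rightarrow> 'v fps"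
  where "fps_scale scale c X = Abs_fps (\<lambda>n. \<Sum>i\<le>n. scale (c $ i) (X $ (n - i)))"

definition fps_grading :: "(bit \<Rightarrow> 'v set) \<Rightarrow> bit \<Rightarrow> 'v fps set"
  where "fps_grading L a = {X. \<forall>n. X $ n \<in> L a}"

text \<open>The \<open>K[[t]]\<close>-(multi)linear extension to \<open>L[[t]]\<close> of a formal series of (multi)linear maps.\<close>

definition fps_ext1 :: "(nat \<Rightarrow> 'v \<Rightarrow> 'v) \<Rightarrow> 'v fps \<Rightarrow> 'v::ab_group_add fps"
  where "fps_ext1 h X = Abs_fps (\<lambda>n. \<Sum>i\<le>n. h i (X $ (n - i)))"

definition fps_ext2 :: "(nat \<Rightarrow> 'v \<Rightarrow> 'v \<Rightarrow> 'v) \<Rightarrow> 'v fps \<Rightarrow> 'v fps \<Rightarrow> 'v::ab_group_add fps"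
  where "fps_ext2 f X Y =
    Abs_fps (\<lambda>n. \<Sum>i\<le>n. \<Sum>j\<le>n-i. f i (X $ j) (Y $ (n - i - j)))"

definition fps_ext3 ::
  "(nat \<Rightarrow> 'v \<Rightarrow> 'v \<Rightarrow> 'v \<Rightarrow> 'v) \<Rightarrow> 'v fps \<Rightarrow> 'v fps \<Rightarrow> 'v fps \<Rightarrow> 'v::ab_group_add fps"
  where "fps_ext3 g X Y Z =
    Abs_fps (\<lambda>n. \<Sum>i\<le>n. \<Sum>j\<le>n-i. \<Sum>k\<le>n-i-j. g i (X $ j) (Y $ k) (Z $ (n - i - j - k)))"

text \<open>A map regarded as a formal series of maps concentrated in order \<open>0\<close>.\<close>

definition const_series :: "'a::zero \<Rightarrow> nat \<Rightarrow> 'a"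
  where "const_series m i = (if i = 0 then m else 0)"


section \<open>Formal deformations\<close>

definition formal_deformation ::
  "('k::comm_ring_1 \<Rightarrow> 'v::ab_group_add \<Rightarrow> 'v) \<Rightarrow> (bit \<Rightarrow> 'v set)
    \<Rightarrow> ('v \<Rightarrow> 'v \<Rightarrow> 'v) \<Rightarrow> ('v \<Rightarrow> 'v \<Rightarrow> 'v \<Rightarrow> 'v) \<Rightarrow> ('v \<Rightarrow> 'v)
    \<Rightarrow> (nat \<Rightarrow> 'v \<Rightarrow> 'v \<Rightarrow> 'v) \<Rightarrow> (nat \<Rightarrow> 'v \<Rightarrow> 'v \<Rightarrow> 'v \<Rightarrow> 'v) \<Rightarrow> bool"
  where "formal_deformation scale L br tr \<alpha> f g \<longleftrightarrow>
    f 0 = br \<and> g 0 = tr \<and>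
    (\<forall>i. even_bilinear scale L (f i)) \<and>
    (\<forall>i. even_trilinear scale L (g i)) \<and>
    hom_lie_yamaguti_superalgebra (fps_scale scale) (fps_grading L)
      (fps_ext2 f) (fps_ext3 g) (fps_ext1 (const_series \<alpha>))"

definition equivalent_deformations ::
  "('k::comm_ring_1 \<Rightarrow> 'v::ab_group_add \<Rightarrow> 'v) \<Rightarrow> (bit \<Rightarrow> 'v set) \<Rightarrow> ('v \<Rightarrow> 'v)
    \<Rightarrow> (nat \<Rightarrow> 'v \<Rightarrow> 'v \<Rightarrow> 'v) \<Rightarrow> (nat \<Rightarrow> 'v \<Rightarrow> 'v \<Rightarrow> 'v \<Rightarrow> 'v)
    \<Rightarrow> (nat \<Rightarrow> 'v \<Rightarrow> 'v \<Rightarrow> 'v) \<Rightarrow> (nat \<Rightarrow> 'v \<Rightarrow> 'v \<Rightarrow> 'v \<Rightarrow> 'v) \<Rightarrow> bool"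
  where "equivalent_deformations scale L \<alpha> f g f' g' \<longleftrightarrow>
    (\<exists>\<phi> :: nat \<Rightarrow> 'v \<Rightarrow> 'v.
      (\<forall>i. even_linear scale L (\<phi> i)) \<and> \<phi> 0 = id \<and>
      module_hom (fps_scale scale) (fps_scale scale) (fps_ext1 \<phi>) \<and> bij (fps_ext1 \<phi>) \<and>
      fps_ext1 \<phi> \<circ> fps_ext1 (const_series \<alpha>) = fps_ext1 (const_series \<alpha>) \<circ> fps_ext1 \<phi> \<and>
      (\<forall>X Y. fps_ext1 \<phi> (fps_ext2 f X Y) = fps_ext2 f' (fps_ext1 \<phi> X) (fps_ext1 \<phi> Y)) \<and>
      (\<forall>X Y Z. fps_ext1 \<phi> (fps_ext3 g X Y Z) =
        fps_ext3 g' (fps_ext1 \<phi> X) (fps_ext1 \<phi> Y) (fps_ext1 \<phi> Z)))"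

definition analytically_rigid ::
  "('k::comm_ring_1 \<Rightarrow> 'v::ab_group_add \<Rightarrow> 'v) \<Rightarrow> (bit \<Rightarrow> 'v set)
    \<Rightarrow> ('v \<Rightarrow> 'v \<Rightarrow> 'v) \<Rightarrow> ('v \<Rightarrow> 'v \<Rightarrow> 'v \<Rightarrow> 'v) \<Rightarrow> ('v \<Rightarrow> 'v) \<Rightarrow> bool"
  where "analytically_rigid scale L br tr \<alpha> \<longleftrightarrow>
    (\<forall>f g. formal_deformation scale L br tr \<alpha> f g \<longrightarrow>
      equivalent_deformations scale L \<alpha> f g (const_series br) (const_series tr))"

end

theory Submission
  imports Defs
begin

text \<open>
  Let \<open>(f, g)\<close> be a deformation. The proof constructs \<open>\<Phi> = id + \<phi>\<^sub>1 t + \<phi>\<^sub>2 t\<^sup>2 + \<dots>\<close>, one coefficient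
  at a time, so that the defects
  \<open>D2(X, Y) = \<Phi>(f(X, Y)) - [\<Phi> X, \<Phi> Y]\<close> and
  \<open>D3(X, Y, Z) = \<Phi>(g(X, Y, Z)) - {\<Phi> X, \<Phi> Y, \<Phi> Z}\<close>
  vanish. Here \<open>[,]\<close> and \<open>{,,}\<close> are the undeformed operations, extended to power series.

  Suppose that the defects vanish below order \<open>n > 0\<close> and let \<open>d, e\<close> be their coefficients of
  order \<open>n\<close>. Then \<open>(d, e)\<close> is a cocycle: apply \<open>\<Phi>\<close> to an axiom of the deformed algebra and push
  \<open>\<Phi>\<close> through the deformed operations with the definition of the defects. For instance
  \<open>\<Phi>(f(f(x, y), \<alpha> z)) = [[\<Phi> x, \<Phi> y], \<alpha> \<Phi> z] + [D2(x, y), \<alpha> \<Phi> z] + D2(f(x, y), \<alpha> z)\<close>.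
  The terms free of defects cancel, because the undeformed operations on power series satisfy the
  same axiom (the \<open>null_\<dots>\<close> lemmas). In the coefficient of \<open>t\<^sup>n\<close> of the remaining terms every
  argument next to the defect contributes only its constant coefficient, and the result is the
  cocycle identity, here \<open>[d(x, y), \<alpha> z] + d([x, y], \<alpha> z)\<close> (lemma \<open>lead_in_Z23\<close>).

  As the cohomology is zero, \<open>(d, e)\<close> is the coboundary of some \<open>h\<close>, and replacing \<open>\<phi>\<^sub>n\<close> by
  \<open>\<phi>\<^sub>n + h\<close> subtracts exactly this coboundary from the coefficients of order \<open>n\<close> of the defects
  (lemma \<open>correction\<close>). Each step leaves the earlier coefficients of \<open>\<Phi>\<close> alone, so the steps
  have a limit; its defects are zero and it is bijective because its constant term is the
  identity. Since the deformation itself is never conjugated, neither inverses nor infinite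
  compositions of gauge transformations occur.

  All bookkeeping with power series rests on one principle: an additive map commuting with
  multiplication by \<open>t\<close> is determined, coefficient by coefficient, by its values on constant
  series.
\<close>

section \<open>Operators on power series that are linear over multiplication by t\<close>

text \<open>
  For a type of coefficients without multiplication there is no product \<open>t X\<close>, so it is defined
  directly.
\<close>

definition times_t :: "'v::zero fps \<Rightarrow> 'v fps"
  where "times_t X = Abs_fps (\<lambda>n. case n of 0 \<Rightarrow> 0 | Suc m \<Rightarrow> X $ m)"

lemma times_t_nth [simp]: "times_t X $ 0 = 0" "times_t X $ Suc m = X $ m"
  by (simp_all add: times_t_def)

lemma times_t_add: "times_t (X + Y) = times_t X + times_t (Y :: 'v::monoid_add fps)"
  and times_t_diff: "times_t (P - Q) = times_t P - times_t (Q :: 'w::group_add fps)"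
  and times_t_minus: "times_t (- P) = - times_t P"
  by (rule fps_ext, case_tac n; simp)+

text \<open>The splitting \<open>X = X\<^sub>0 + t X'\<close> on which every induction over coefficients below is based.\<close>

lemma fps_head_tail: "X = fps_const (X $ 0) + times_t (fps_shift 1 X)"
  for X :: "'v::monoid_add fps"
proof (rule fps_ext)
  show "X $ n = (fps_const (X $ 0) + times_t (fps_shift 1 X)) $ n" for n
    by (cases n) simp_all
qed

definition t_linear :: "('v::ab_group_add fps \<Rightarrow> 'w::ab_group_add fps) \<Rightarrow> bool"
  where "t_linear T \<longleftrightarrow> additive T \<and> (\<forall>X. T (times_t X) = times_t (T X))"

lemma t_linear_times_t: "t_linear T \<Longrightarrow> T (times_t X) = times_t (T X)"
  by (simp add: t_linear_def)

lemma
  assumes "t_linear T"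
  shows t_linear_add: "T (X + Y) = T X + T Y"
    and t_linear_minus: "T (- X) = - T X"
    and t_linear_diff: "T (X - Y) = T X - T Y"
    and t_linear_zero: "T 0 = 0"
proof -
  interpret additive T
    using assms by (simp add: t_linear_def)
  show "T (X + Y) = T X + T Y" "T (- X) = - T X" "T (X - Y) = T X - T Y" "T 0 = 0"
    by (rule add minus diff zero)+
qed

lemma t_linearI:
  "(\<And>X Y. T (X + Y) = T X + T Y) \<Longrightarrow> (\<And>X. T (times_t X) = times_t (T X)) \<Longrightarrow> t_linear T"
  by (simp add: t_linear_def additive_def)

lemma t_linear_ident: "t_linear (\<lambda>X. X)"
  by (simp add: t_linearI)

lemma
  assumes S: "t_linear S" and T: "t_linear T"
  shows t_linear_plus: "t_linear (\<lambda>X. S X + T X)"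
    and t_linear_sub: "t_linear (\<lambda>X. S X - T X)"
  by (simp_all add: t_linearI t_linear_add[OF S] t_linear_times_t[OF S] t_linear_add[OF T]
      t_linear_times_t[OF T] times_t_add times_t_diff)

lemma t_linear_compose:
  assumes S: "t_linear S" and T: "t_linear T"
  shows "t_linear (\<lambda>X. S (T X))"
  by (simp add: t_linearI t_linear_add[OF S] t_linear_times_t[OF S] t_linear_add[OF T]
      t_linear_times_t[OF T])

lemma sgn_pow_add: "sgn_pow e (x + y) = sgn_pow e x + sgn_pow e y"
  by (simp add: sgn_pow_def)

lemma sgn_pow_diff: "sgn_pow e (x - y) = sgn_pow e x - sgn_pow e y"
  by (simp add: sgn_pow_def)

lemma sgn_pow_zero [simp]: "sgn_pow e 0 = 0"
  by (simp add: sgn_pow_def)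

lemma sgn_pow_nth: "sgn_pow e X $ n = sgn_pow e (X $ n)"
  by (simp add: sgn_pow_def)

lemma t_linear_apply_sgn_pow: "t_linear T \<Longrightarrow> T (sgn_pow e X) = sgn_pow e (T X)"
  by (simp add: sgn_pow_def) (metis t_linear_minus)

lemma t_linear_sgn_pow:
  assumes T: "t_linear T"
  shows "t_linear (\<lambda>X. sgn_pow e (T X))"
  by (cases "e = 0") (simp_all add: sgn_pow_def t_linearI t_linear_add[OF T] t_linear_times_t[OF T]
      times_t_minus)

text \<open>
  From \<open>T X = T X\<^sub>0 + t T X'\<close> the coefficient of order \<open>k\<close> of \<open>T X\<close> is that of a constant series
  plus one of order \<open>k - 1\<close>. The set \<open>S\<close> is the type's universe or a homogeneous component.
\<close>

lemma t_linear_vanish_below: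
  assumes T: "t_linear T" and const: "\<And>x k. x \<in> S \<Longrightarrow> k < n \<Longrightarrow> T (fps_const x) $ k = 0"
    and X: "\<And>i. X $ i \<in> S" and k: "k < n"
  shows "T X $ k = 0"
  using X k
proof (induction k arbitrary: X)
  case 0
  have "T X $ 0 = T (fps_const (X $ 0)) $ 0 + T (times_t (fps_shift 1 X)) $ 0"
    by (metis T fps_add_nth fps_head_tail t_linear_add)
  with 0 show ?case
    by (simp add: const t_linear_times_t[OF T])
next
  case (Suc k)
  have "T X $ Suc k = T (fps_const (X $ 0)) $ Suc k + T (times_t (fps_shift 1 X)) $ Suc k"
    by (metis T fps_add_nth fps_head_tail t_linear_add)
  moreover have "T (fps_shift 1 X) $ k = 0"
    using Suc by simp
  ultimately show ?case
    using Suc.prems by (simp add: const t_linear_times_t[OF T])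
qed

lemma t_linear_vanish:
  assumes "t_linear T" "\<And>x. x \<in> S \<Longrightarrow> T (fps_const x) = 0" "\<And>i. X $ i \<in> S"
  shows "T X = 0"
proof (rule fps_ext)
  show "T X $ n = 0 $ n" for n
    using t_linear_vanish_below[OF assms(1), of S "Suc n" X n] assms(2,3) by simp
qed

text \<open>
  A defect will vanish to order \<open>n\<close> on constants; its coefficient of order \<open>n\<close> on a series then
  sees only the constant term of that series.
\<close>

lemma t_linear_leading_nth:
  assumes T: "t_linear T" and const: "\<And>x k. k < n \<Longrightarrow> T (fps_const x) $ k = 0"
  shows "T X $ n = T (fps_const (X $ 0)) $ n"
proof -
  have "T X $ n = T (fps_const (X $ 0)) $ n + times_t (T (fps_shift 1 X)) $ n"
    by (metis T fps_add_nth fps_head_tail t_linear_add t_linear_times_t)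
  moreover have "times_t (T (fps_shift 1 X)) $ n = 0"
    using t_linear_vanish_below[OF T, of UNIV n] const by (cases n) auto
  ultimately show ?thesis
    by simp
qed

text \<open>
  Conversely, if the argument vanishes to order \<open>n\<close>, then \<open>P = t\<^sup>n P'\<close> and \<open>T P = t\<^sup>n T P'\<close>.
\<close>

lemma t_linear_order:
  assumes T: "t_linear T" and P: "\<And>k. k < n \<Longrightarrow> P $ k = 0" and "k \<le> n"
  shows "T P $ k = (if k = n then T (fps_const (P $ n)) $ 0 else 0)"
  using P \<open>k \<le> n\<close>
proof (induction n arbitrary: P k)
  case 0
  then show ?case
    using t_linear_leading_nth[OF T, of 0] by simp
next
  case (Suc n)
  have "P = times_t (fps_shift 1 P)"
    using fps_head_tail[of P] Suc.prems(1)[of 0] by simp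
  then have eq: "T P = times_t (T (fps_shift 1 P))"
    by (metis T t_linear_times_t)
  show ?case
  proof (cases k)
    case 0
    then show ?thesis
      by (simp add: eq)
  next
    case (Suc j)
    then have "T (fps_shift 1 P) $ j = (if j = n then T (fps_const (fps_shift 1 P $ n)) $ 0 else 0)"
      using Suc.prems by (intro Suc.IH) auto
    with Suc show ?thesis
      by (simp add: eq)
  qed
qed


section \<open>Extensions of series of multilinear maps\<close>

lemma sum_times_t_right:
  assumes "\<And>i. q i 0 = 0"
  shows "(\<Sum>j\<le>Suc m. q j (times_t X $ (Suc m - j))) = (\<Sum>j\<le>m. q j (X $ (m - j)))"
  using assms by (simp add: Suc_diff_le)

lemma t_linear_ext1:
  assumes "\<And>i. additive (h i)"
  shows "t_linear (fps_ext1 h)"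
proof (rule t_linearI; rule fps_ext)
  fix X Y n
  show "fps_ext1 h (X + Y) $ n = (fps_ext1 h X + fps_ext1 h Y) $ n"
    by (simp add: fps_ext1_def additive.add[OF assms] sum.distrib)
  show "fps_ext1 h (times_t X) $ n = times_t (fps_ext1 h X) $ n"
  proof (cases n)
    case 0
    then show ?thesis
      by (simp add: fps_ext1_def additive.zero[OF assms])
  next
    case (Suc m)
    then show ?thesis
      using sum_times_t_right[where q = h and m = m and X = X, OF additive.zero[OF assms]]
      by (simp add: fps_ext1_def del: sum.atMost_Suc)
  qed
qed

lemma additive_sum: "(\<And>i. i \<in> I \<Longrightarrow> additive (h i)) \<Longrightarrow> additive (\<lambda>x. \<Sum>i\<in>I. h i x)"
  by (simp add: additive_def sum.distrib)

text \<open>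
  The nested sums of the extensions run over lattice points \<open>i + j \<le> n\<close>; they are compared by
  exchanging the coordinates or by summing along the diagonals \<open>i + j = m\<close>.
\<close>

lemma sum_simplex:
  "(\<Sum>i\<le>n. \<Sum>j\<le>n - i. p i j) = (\<Sum>(i, j)\<in>{(i, j). i + j \<le> n}. p i (j :: nat))"
  unfolding sum.Sigma[OF finite_atMost ballI[OF finite_atMost]] by (rule sum.cong) auto

lemma sum_simplex_swap: "(\<Sum>i\<le>n. \<Sum>j\<le>n - i. p i j) = (\<Sum>j\<le>n. \<Sum>i\<le>n - j. p i (j :: nat))"
  unfolding sum_simplex sum_simplex[where p = "\<lambda>j i. p i j"]
  by (rule sum.reindex_bij_witness[of _ "\<lambda>(j, i). (i, j)" "\<lambda>(i, j). (j, i)"]) auto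

lemma sum_simplex_diag: "(\<Sum>i\<le>n. \<Sum>j\<le>n - i. p i j) = (\<Sum>m\<le>n. \<Sum>i\<le>m. p i (m - i :: nat))"
  by (simp only: sum_simplex sum.triangle_reindex_eq)

text \<open>
  In each argument a bi- or trilinear extension is itself the extension of a series of linear maps
  obtained by inserting the coefficients of the other arguments.
\<close>

lemma fps_ext2_conv_ext1: "fps_ext2 f X = fps_ext1 (\<lambda>m y. \<Sum>i\<le>m. f i (X $ (m - i)) y)"
proof (rule ext, rule fps_ext)
  fix Y n
  show "fps_ext2 f X Y $ n = fps_ext1 (\<lambda>m y. \<Sum>i\<le>m. f i (X $ (m - i)) y) Y $ n"
    by (simp add: fps_ext1_def fps_ext2_def sum_simplex_diag)
qed

lemma sum_atMost_rev: "(\<Sum>j\<le>n. p j) = (\<Sum>j\<le>n. p (n - j :: nat))"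
  by (rule sum.reindex_bij_witness[of _ "\<lambda>j. n - j" "\<lambda>j. n - j"]) auto

lemma fps_ext2_flip: "fps_ext2 f X Y = fps_ext2 (\<lambda>i y x. f i x y) Y X"
proof (rule fps_ext)
  fix n
  show "fps_ext2 f X Y $ n = fps_ext2 (\<lambda>i y x. f i x y) Y X $ n"
    unfolding fps_ext2_def fps_nth_Abs_fps
    by (rule sum.cong[OF refl], subst sum_atMost_rev) simp
qed

lemma fps_ext3_conv_ext2: "fps_ext3 g X = fps_ext2 (\<lambda>m y z. \<Sum>i\<le>m. g i (X $ (m - i)) y z)"
proof (intro ext fps_ext)
  fix Y Z n
  have "fps_ext3 g X Y Z $ n =
      (\<Sum>m\<le>n. \<Sum>i\<le>m. \<Sum>k\<le>n - m. g i (X $ (m - i)) (Y $ k) (Z $ (n - m - k)))"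
    by (simp add: fps_ext3_def sum_simplex_diag)
  also have "\<dots> = (\<Sum>m\<le>n. \<Sum>k\<le>n - m. \<Sum>i\<le>m. g i (X $ (m - i)) (Y $ k) (Z $ (n - m - k)))"
    by (rule sum.cong[OF refl], rule sum.swap)
  finally show "fps_ext3 g X Y Z $ n = fps_ext2 (\<lambda>m y z. \<Sum>i\<le>m. g i (X $ (m - i)) y z) Y Z $ n"
    by (simp add: fps_ext2_def)
qed

lemma fps_ext3_flip: "fps_ext3 g X Y Z = fps_ext3 (\<lambda>i y x z. g i x y z) Y X Z"
proof (rule fps_ext)
  fix n
  show "fps_ext3 g X Y Z $ n = fps_ext3 (\<lambda>i y x z. g i x y z) Y X Z $ n"
    unfolding fps_ext3_def fps_nth_Abs_fps
    by (rule sum.cong[OF refl], subst sum_simplex_swap) (simp add: add_ac)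
qed

lemma t_linear_ext2:
  assumes "\<And>i y. additive (\<lambda>x. f i x y)" "\<And>i x. additive (f i x)"
  shows "t_linear (\<lambda>X. fps_ext2 f X Y)" "t_linear (fps_ext2 f X)"
proof -
  show "t_linear (fps_ext2 f X)"
    unfolding fps_ext2_conv_ext1 by (intro t_linear_ext1 additive_sum assms)
  have "t_linear (fps_ext2 (\<lambda>i y x. f i x y) Y)"
    unfolding fps_ext2_conv_ext1 by (intro t_linear_ext1 additive_sum assms)
  then show "t_linear (\<lambda>X. fps_ext2 f X Y)"
    unfolding fps_ext2_flip[of f _ Y] .
qed

lemma t_linear_ext3:
  assumes "\<And>i y z. additive (\<lambda>x. g i x y z)" "\<And>i x z. additive (\<lambda>y. g i x y z)"
    "\<And>i x y. additive (g i x y)"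
  shows "t_linear (\<lambda>X. fps_ext3 g X Y Z)" "t_linear (\<lambda>Y. fps_ext3 g X Y Z)"
    "t_linear (fps_ext3 g X Y)"
proof -
  show "t_linear (\<lambda>Y. fps_ext3 g X Y Z)" "t_linear (fps_ext3 g X Y)"
    unfolding fps_ext3_conv_ext2 by (intro t_linear_ext2 additive_sum assms)+
  have "t_linear (\<lambda>X. fps_ext3 (\<lambda>i y x z. g i x y z) Y X Z)"
    unfolding fps_ext3_conv_ext2 by (intro t_linear_ext2 additive_sum assms)+
  then show "t_linear (\<lambda>X. fps_ext3 g X Y Z)"
    unfolding fps_ext3_flip[of g _ Y] .
qed

lemma fps_ext_nth_0:
  "fps_ext1 h X $ 0 = h 0 (X $ 0)"
  "fps_ext2 f X Y $ 0 = f 0 (X $ 0) (Y $ 0)"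
  "fps_ext3 g X Y Z $ 0 = g 0 (X $ 0) (Y $ 0) (Z $ 0)"
  by (simp_all add: fps_ext1_def fps_ext2_def fps_ext3_def)

lemma sum_only_last: "(\<And>i. i < n \<Longrightarrow> p i = 0) \<Longrightarrow> sum p {..n} = p (n :: nat)"
  by (simp add: lessThan_Suc_atMost[symmetric])

lemma fps_ext1_const:
  assumes "\<And>i. additive (h i)"
  shows "fps_ext1 h (fps_const x) $ n = h n x"
  by (simp add: fps_ext1_def sum_only_last additive.zero[OF assms])

lemma fps_ext2_const:
  assumes "\<And>i y. additive (\<lambda>x. f i x y)" "\<And>i x. additive (f i x)"
  shows "fps_ext2 f (fps_const x) (fps_const y) $ n = f n x y"
  unfolding fps_ext2_conv_ext1
  by (subst fps_ext1_const)
    (auto intro!: additive_sum assms simp: sum_only_last additive.zero[OF assms(1)])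

lemma fps_ext3_const:
  assumes "\<And>i y z. additive (\<lambda>x. g i x y z)" "\<And>i x z. additive (\<lambda>y. g i x y z)"
    "\<And>i x y. additive (g i x y)"
  shows "fps_ext3 g (fps_const x) (fps_const y) (fps_const z) $ n = g n x y z"
  unfolding fps_ext3_conv_ext2
  by (subst fps_ext2_const)
    (auto intro!: additive_sum assms simp: sum_only_last additive.zero[OF assms(1)])

lemma fps_ext1_const_series:
  fixes h :: "'v \<Rightarrow> 'v::ab_group_add"
  shows "fps_ext1 (const_series h) X $ n = h (X $ n)"
proof -
  have "(\<Sum>i\<le>n. const_series h i (X $ (n - i))) = (\<Sum>i\<le>n. if i = 0 then h (X $ n) else 0)"
    by (rule sum.cong) (simp_all add: const_series_def)
  then show ?thesis
    by (simp add: fps_ext1_def)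
qed

lemma fps_ext2_const_series:
  fixes f :: "'v \<Rightarrow> 'v \<Rightarrow> 'v::ab_group_add"
  shows "fps_ext2 (const_series f) X Y $ n = (\<Sum>j\<le>n. f (X $ j) (Y $ (n - j)))"
proof -
  have "(\<Sum>i\<le>n. \<Sum>j\<le>n - i. const_series f i (X $ j) (Y $ (n - i - j))) =
    (\<Sum>i\<le>n. if i = 0 then (\<Sum>j\<le>n. f (X $ j) (Y $ (n - j))) else 0)"
    by (rule sum.cong) (simp_all add: const_series_def)
  then show ?thesis
    by (simp add: fps_ext2_def)
qed

lemma fps_ext3_const_series:
  fixes g :: "'v \<Rightarrow> 'v \<Rightarrow> 'v \<Rightarrow> 'v::ab_group_add"
  shows "fps_ext3 (const_series g) X Y Z $ n =
    (\<Sum>j\<le>n. \<Sum>k\<le>n - j. g (X $ j) (Y $ k) (Z $ (n - j - k)))"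
proof -
  have "(\<Sum>i\<le>n. \<Sum>j\<le>n - i. \<Sum>k\<le>n - i - j.
      const_series g i (X $ j) (Y $ k) (Z $ (n - i - j - k))) =
    (\<Sum>i\<le>n. if i = 0 then (\<Sum>j\<le>n. \<Sum>k\<le>n - j. g (X $ j) (Y $ k) (Z $ (n - j - k))) else 0)"
    by (rule sum.cong) (simp_all add: const_series_def)
  then show ?thesis
    by (simp add: fps_ext3_def)
qed


text \<open>
  A preimage of \<open>Y\<close> under \<open>id + h\<^sub>1 t + h\<^sub>2 t\<^sup>2 + \<dots>\<close>, found by solving the equation of order \<open>n\<close> for
  the coefficient of order \<open>n\<close>.
\<close>

fun unipotent_preimage :: "(nat \<Rightarrow> 'v \<Rightarrow> 'v) \<Rightarrow> 'v fps \<Rightarrow> nat \<Rightarrow> 'v::ab_group_add"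
  where "unipotent_preimage h Y n = Y $ n - (\<Sum>i<n. h (n - i) (unipotent_preimage h Y i))"

declare unipotent_preimage.simps [simp del]

lemma bij_unipotent_ext1:
  assumes "\<And>i. additive (h i)" and h_0: "h 0 = id"
  shows "bij (fps_ext1 h)"
proof (rule bijI)
  have T: "t_linear (fps_ext1 h)"
    by (rule t_linear_ext1) fact
  show "inj (fps_ext1 h)"
  proof (rule injI)
    fix X Y assume "fps_ext1 h X = fps_ext1 h Y"
    then have 0: "fps_ext1 h (X - Y) = 0"
      by (simp add: t_linear_diff[OF T])
    have "(X - Y) $ n = 0" for n
    proof (induction n rule: less_induct)
      case (less n)
      then have "fps_ext1 h (X - Y) $ n = (X - Y) $ n"
        using t_linear_order[OF T, of n "X - Y" n] by (simp add: fps_ext_nth_0 h_0)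
      with 0 show ?case
        by simp
    qed
    then show "X = Y"
      by (simp add: fps_eq_iff)
  qed
  show "surj (fps_ext1 h)"
  proof (rule surjI)
    fix Y
    show "fps_ext1 h (Abs_fps (unipotent_preimage h Y)) = Y"
    proof (rule fps_ext)
      fix n
      have "fps_ext1 h (Abs_fps (unipotent_preimage h Y)) $ n =
          (\<Sum>i\<le>n. h (n - i) (unipotent_preimage h Y i))"
        unfolding fps_ext1_def fps_nth_Abs_fps by (subst sum_atMost_rev) simp
      also have "\<dots> = (\<Sum>i<n. h (n - i) (unipotent_preimage h Y i)) + unipotent_preimage h Y n"
        by (simp add: lessThan_Suc_atMost[symmetric] h_0)
      also have "\<dots> = Y $ n"
        by (subst (2) unipotent_preimage.simps) simp
      finally show "fps_ext1 h (Abs_fps (unipotent_preimage h Y)) $ n = Y $ n" .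
    qed
  qed
qed


section \<open>Even multilinear maps\<close>

context superspace
begin

lemma
  shows zero_in_L: "0 \<in> L a"
    and add_in_L: "x \<in> L a \<Longrightarrow> y \<in> L a \<Longrightarrow> x + y \<in> L a"
    and diff_in_L: "x \<in> L a \<Longrightarrow> y \<in> L a \<Longrightarrow> x - y \<in> L a"
    and sum_in_L: "(\<And>i. i \<in> I \<Longrightarrow> v i \<in> L a) \<Longrightarrow> sum v I \<in> L a"
  using subspace_grading by (simp_all add: subspace_0 subspace_add subspace_diff subspace_sum)

lemma module_hom_self_iff:
  "module_hom scale scale h \<longleftrightarrow> (\<forall>x y. h (x + y) = h x + h y) \<and> (\<forall>c x. h (c *s x) = c *s h x)"
  by (simp add: module_hom_iff module_axioms)

lemmas even_defs =
  even_linear_def even_bilinear_def even_trilinear_def module_hom_self_iff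

lemma even_linear_add:
  "even_linear scale L h \<Longrightarrow> even_linear scale L h' \<Longrightarrow> even_linear scale L (\<lambda>x. h x + h' x)"
  by (simp add: even_defs add_in_L scale_right_distrib)

lemma even_linear_id: "even_linear scale L id"
  and even_linear_zero: "even_linear scale L 0"
  and even_bilinear_zero: "even_bilinear scale L 0"
  and even_trilinear_zero: "even_trilinear scale L 0"
  by (simp_all add: even_defs zero_in_L)

lemma even_bilinear_diff:
  "even_bilinear scale L f \<Longrightarrow> even_bilinear scale L f' \<Longrightarrow>
    even_bilinear scale L (\<lambda>x y. f x y - f' x y)"
  by (simp add: even_defs diff_in_L scale_right_diff_distrib)

lemma even_trilinear_diff:
  "even_trilinear scale L g \<Longrightarrow> even_trilinear scale L g' \<Longrightarrow>
    even_trilinear scale L (\<lambda>x y z. g x y z - g' x y z)"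
  by (simp add: even_defs diff_in_L scale_right_diff_distrib)

lemma even_bilinear_sum:
  "(\<And>i. i \<in> I \<Longrightarrow> even_bilinear scale L (f i)) \<Longrightarrow>
    even_bilinear scale L (\<lambda>x y. \<Sum>i\<in>I. f i x y)"
  by (simp add: even_defs sum_in_L sum.distrib scale_sum_right)

lemma even_trilinear_sum:
  "(\<And>i. i \<in> I \<Longrightarrow> even_trilinear scale L (g i)) \<Longrightarrow>
    even_trilinear scale L (\<lambda>x y z. \<Sum>i\<in>I. g i x y z)"
  by (simp add: even_defs sum_in_L sum.distrib scale_sum_right)

lemma even_bilinear_compose_linear:
  "even_linear scale L h \<Longrightarrow> even_bilinear scale L f \<Longrightarrow> even_bilinear scale L (\<lambda>x y. h (f x y))"
  by (simp add: even_defs)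

lemma even_trilinear_compose_linear:
  "even_linear scale L h \<Longrightarrow> even_trilinear scale L g \<Longrightarrow>
    even_trilinear scale L (\<lambda>x y z. h (g x y z))"
  by (simp add: even_defs)

lemma even_bilinear_substitute:
  "even_bilinear scale L f \<Longrightarrow> even_linear scale L h \<Longrightarrow> even_linear scale L h' \<Longrightarrow>
    even_bilinear scale L (\<lambda>x y. f (h x) (h' y))"
  by (simp add: even_defs)

lemma even_trilinear_substitute:
  "even_trilinear scale L g \<Longrightarrow> even_linear scale L h \<Longrightarrow> even_linear scale L h' \<Longrightarrow>
    even_linear scale L h'' \<Longrightarrow> even_trilinear scale L (\<lambda>x y z. g (h x) (h' y) (h'' z))"
  by (simp add: even_defs)

lemma even_linear_additive: "even_linear scale L h \<Longrightarrow> additive h"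
  by (simp add: even_defs additive_def)

lemma even_bilinear_additive:
  assumes "even_bilinear scale L f"
  shows "additive (\<lambda>x. f x y)" "additive (f x)"
  using assms by (simp_all add: even_defs additive_def)

lemma even_trilinear_additive:
  assumes "even_trilinear scale L g"
  shows "additive (\<lambda>x. g x y z)" "additive (\<lambda>y. g x y z)" "additive (g x y)"
  using assms by (simp_all add: even_defs additive_def)

lemma even_const_series:
  "even_linear scale L h \<Longrightarrow> even_linear scale L (const_series h i)"
  "even_bilinear scale L f \<Longrightarrow> even_bilinear scale L (const_series f i)"
  "even_trilinear scale L g \<Longrightarrow> even_trilinear scale L (const_series g i)"
  by (simp_all add: const_series_def even_linear_zero even_bilinear_zero even_trilinear_zero)

lemma fps_const_in_grading: "x \<in> L a \<Longrightarrow> fps_const x \<in> fps_grading L a"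
  by (simp add: fps_grading_def zero_in_L)

end


section \<open>The null deformation\<close>

lemma t_linear_vanish_grading:
  assumes "t_linear T" "\<And>x. x \<in> L a \<Longrightarrow> T (fps_const x) = 0" "X \<in> fps_grading L a"
  shows "T X = 0"
  using assms by (intro t_linear_vanish[of T "L a" X]) (auto simp: fps_grading_def)

lemma t_trilinear_vanish:
  assumes "\<And>Y Z. t_linear (\<lambda>X. S X Y Z)" "\<And>X Z. t_linear (\<lambda>Y. S X Y Z)" "\<And>X Y. t_linear (S X Y)"
    and "\<And>x y z. x \<in> L a \<Longrightarrow> y \<in> L b \<Longrightarrow> z \<in> L c \<Longrightarrow> S (fps_const x) (fps_const y) (fps_const z) = 0"
    and X: "X \<in> fps_grading L a" and Y: "Y \<in> fps_grading L b" and Z: "Z \<in> fps_grading L c"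
  shows "S X Y Z = 0"
proof -
  have 1: "S (fps_const x) (fps_const y) Z = 0" if "x \<in> L a" "y \<in> L b" for x y
    by (rule t_linear_vanish_grading[OF assms(3) assms(4)[OF that] Z])
  have 2: "S (fps_const x) Y Z = 0" if "x \<in> L a" for x
    by (rule t_linear_vanish_grading[where T = "\<lambda>Y. S _ Y Z", OF assms(2) 1[OF that] Y])
  show ?thesis
    by (rule t_linear_vanish_grading[where T = "\<lambda>X. S X Y Z", OF assms(1) 2 X])
qed

text \<open>
  The undeformed operations on power series satisfy the identities of the algebra on homogeneous
  series: both sides are \<open>t\<close>-linear in every variable and agree on constants.
\<close>

context hom_lie_yamaguti_superalgebra
begin

abbreviation "brt \<equiv> fps_ext2 (const_series br)"
abbreviation "trt \<equiv> fps_ext3 (const_series tr)"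
abbreviation "\<alpha>t \<equiv> fps_ext1 (const_series \<alpha>)"

lemmas null_additive =
  even_linear_additive[OF even_const_series(1)[OF even_\<alpha>]]
  even_bilinear_additive[OF even_const_series(2)[OF even_br]]
  even_trilinear_additive[OF even_const_series(3)[OF even_tr]]

lemma t_linear_\<alpha>t: "t_linear \<alpha>t"
  by (intro t_linear_ext1 null_additive)

lemma t_linear_brt: "t_linear (\<lambda>X. brt X Y)" "t_linear (brt X)"
  by (intro t_linear_ext2 null_additive)+

lemma t_linear_trt:
  "t_linear (\<lambda>X. trt X Y Z)" "t_linear (\<lambda>Y. trt X Y Z)" "t_linear (trt X Y)"
  by (intro t_linear_ext3 null_additive)+

lemma null_extension_const:
  "\<alpha>t (fps_const x) = fps_const (\<alpha> x)"
  "brt (fps_const x) (fps_const y) = fps_const (br x y)"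
  "trt (fps_const x) (fps_const y) (fps_const z) = fps_const (tr x y z)"
proof -
  have "\<alpha>t (fps_const x) $ n = const_series \<alpha> n x"
    "brt (fps_const x) (fps_const y) $ n = const_series br n x y"
    "trt (fps_const x) (fps_const y) (fps_const z) $ n = const_series tr n x y z" for n
    by (intro fps_ext1_const fps_ext2_const fps_ext3_const null_additive)+
  then show "\<alpha>t (fps_const x) = fps_const (\<alpha> x)"
    "brt (fps_const x) (fps_const y) = fps_const (br x y)"
    "trt (fps_const x) (fps_const y) (fps_const z) = fps_const (tr x y z)"
    by (simp_all add: fps_eq_iff const_series_def)
qed

lemma sgn_pow_const: "sgn_pow e (fps_const x) = fps_const (sgn_pow e x)"
  by (simp add: sgn_pow_def)

lemmas t_linear_intros = t_linear_ident t_linear_plus t_linear_sub t_linear_sgn_pow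
  t_linear_compose[OF t_linear_\<alpha>t]
  t_linear_compose[OF t_linear_brt(1)] t_linear_compose[OF t_linear_brt(2)]
  t_linear_compose[OF t_linear_trt(1)] t_linear_compose[OF t_linear_trt(2)]
  t_linear_compose[OF t_linear_trt(3)]

lemma null_br_skew:
  assumes X: "X \<in> fps_grading L a" and Y: "Y \<in> fps_grading L b"
  shows "brt X Y = - sgn_pow (a * b) (brt Y X)"
proof -
  let ?S = "\<lambda>X Y. brt X Y + sgn_pow (a * b) (brt Y X)"
  have "?S X Y = 0"
  proof (rule t_linear_vanish_grading[where T = "\<lambda>X. ?S X Y", OF _ _ X])
    fix x assume x: "x \<in> L a"
    show "?S (fps_const x) Y = 0"
    proof (rule t_linear_vanish_grading[where T = "\<lambda>Y. ?S _ Y", OF _ _ Y])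
      fix y assume "y \<in> L b"
      then show "?S (fps_const x) (fps_const y) = 0"
        using br_skew[OF x, of y b] by (simp add: null_extension_const sgn_pow_const)
    qed (intro t_linear_intros)
  qed (intro t_linear_intros)
  then show ?thesis
    by (simp add: eq_neg_iff_add_eq_0)
qed

lemma null_tr_skew:
  assumes "X \<in> fps_grading L a" "Y \<in> fps_grading L b" "Z \<in> fps_grading L c"
  shows "trt X Y Z = - sgn_pow (a * b) (trt Y X Z)"
proof -
  let ?S = "\<lambda>X Y Z. trt X Y Z + sgn_pow (a * b) (trt Y X Z)"
  have "?S X Y Z = 0"
    using _ _ _ _ assms
  proof (rule t_trilinear_vanish[of ?S])
    fix x y z assume "x \<in> L a" "y \<in> L b" "z \<in> L c"
    then show "?S (fps_const x) (fps_const y) (fps_const z) = 0"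
      using tr_skew[of x a y b z c] by (simp add: null_extension_const sgn_pow_const)
  qed (intro t_linear_intros)+
  then show ?thesis
    by (simp add: eq_neg_iff_add_eq_0)
qed

lemma null_\<alpha>_br:
  assumes X: "X \<in> fps_grading L a" and Y: "Y \<in> fps_grading L b"
  shows "\<alpha>t (brt X Y) = brt (\<alpha>t X) (\<alpha>t Y)"
proof -
  let ?S = "\<lambda>X Y. \<alpha>t (brt X Y) - brt (\<alpha>t X) (\<alpha>t Y)"
  have "?S X Y = 0"
  proof (rule t_linear_vanish_grading[where T = "\<lambda>X. ?S X Y", OF _ _ X])
    fix x assume x: "x \<in> L a"
    show "?S (fps_const x) Y = 0"
      by (rule t_linear_vanish_grading[where T = "\<lambda>Y. ?S _ Y", OF _ _ Y], intro t_linear_intros)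
        (simp add: null_extension_const \<alpha>_br[OF x])
  qed (intro t_linear_intros)
  then show ?thesis
    by simp
qed

lemma null_\<alpha>_tr:
  assumes "X \<in> fps_grading L a" "Y \<in> fps_grading L b" "Z \<in> fps_grading L c"
  shows "\<alpha>t (trt X Y Z) = trt (\<alpha>t X) (\<alpha>t Y) (\<alpha>t Z)"
proof -
  let ?S = "\<lambda>X Y Z. \<alpha>t (trt X Y Z) - trt (\<alpha>t X) (\<alpha>t Y) (\<alpha>t Z)"
  have "?S X Y Z = 0"
    using _ _ _ _ assms
  proof (rule t_trilinear_vanish[of ?S])
    fix x y z assume "x \<in> L a" "y \<in> L b" "z \<in> L c"
    then show "?S (fps_const x) (fps_const y) (fps_const z) = 0"
      using \<alpha>_tr[of x a y b z c] by (simp add: null_extension_const)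
  qed (intro t_linear_intros)+
  then show ?thesis
    by simp
qed

lemma null_cyclic_br:
  assumes "X \<in> fps_grading L a" "Y \<in> fps_grading L b" "Z \<in> fps_grading L c"
  shows "cyclic_sum (\<lambda>X Y Z. brt (brt X Y) (\<alpha>t Z) + trt X Y Z) a b c X Y Z = 0"
  using _ _ _ _ assms
proof (rule t_trilinear_vanish[of "cyclic_sum (\<lambda>X Y Z. brt (brt X Y) (\<alpha>t Z) + trt X Y Z) a b c"])
  fix x y z assume "x \<in> L a" "y \<in> L b" "z \<in> L c"
  then show "cyclic_sum (\<lambda>X Y Z. brt (brt X Y) (\<alpha>t Z) + trt X Y Z) a b c
      (fps_const x) (fps_const y) (fps_const z) = 0"
    using cyclic_br[of x a y b z c]
    by (simp add: cyclic_sum_def null_extension_const sgn_pow_const)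
qed (unfold cyclic_sum_def, (intro t_linear_intros)+)

lemma null_cyclic_tr:
  assumes "X \<in> fps_grading L a" "Y \<in> fps_grading L b" "Z \<in> fps_grading L c"
    and U: "U \<in> fps_grading L d"
  shows "cyclic_sum (\<lambda>X Y Z. trt (brt X Y) (\<alpha>t Z) (\<alpha>t U)) a b c X Y Z = 0"
    (is "?S U X Y Z = 0")
  using _ _ _ _ assms(1-3)
proof (rule t_trilinear_vanish[of "?S U"])
  fix x y z assume xyz: "x \<in> L a" "y \<in> L b" "z \<in> L c"
  show "?S U (fps_const x) (fps_const y) (fps_const z) = 0"
  proof (rule t_linear_vanish_grading[OF _ _ U])
    fix u assume "u \<in> L d"
    then show "?S (fps_const u) (fps_const x) (fps_const y) (fps_const z) = 0"
      using cyclic_tr[of x a y b z c u d] xyz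
      by (simp add: cyclic_sum_def null_extension_const sgn_pow_const)
  qed (unfold cyclic_sum_def, intro t_linear_intros)
qed (unfold cyclic_sum_def, (intro t_linear_intros)+)

lemma null_tr_br:
  assumes "X \<in> fps_grading L a" "Y \<in> fps_grading L b" "U \<in> fps_grading L c"
    and V: "V \<in> fps_grading L d"
  shows "trt (\<alpha>t X) (\<alpha>t Y) (brt U V) =
    brt (trt X Y U) (\<alpha>t (\<alpha>t V)) + sgn_pow (c * (a + b)) (brt (\<alpha>t (\<alpha>t U)) (trt X Y V))"
proof -
  let ?S = "\<lambda>V X Y U. trt (\<alpha>t X) (\<alpha>t Y) (brt U V) -
    (brt (trt X Y U) (\<alpha>t (\<alpha>t V)) + sgn_pow (c * (a + b)) (brt (\<alpha>t (\<alpha>t U)) (trt X Y V)))"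
  have "?S V X Y U = 0"
    using _ _ _ _ assms(1-3)
  proof (rule t_trilinear_vanish[of "?S V"])
    fix x y u assume xyu: "x \<in> L a" "y \<in> L b" "u \<in> L c"
    show "?S V (fps_const x) (fps_const y) (fps_const u) = 0"
    proof (rule t_linear_vanish_grading[where T = "\<lambda>V. ?S V _ _ _", OF _ _ V])
      fix v assume "v \<in> L d"
      then show "?S (fps_const v) (fps_const x) (fps_const y) (fps_const u) = 0"
        using tr_br[of x a y b u c v d] xyu
        by (simp add: null_extension_const sgn_pow_const)
    qed (intro t_linear_intros)
  qed (intro t_linear_intros)+
  then show ?thesis
    by simp
qed

lemma null_tr_tr:
  assumes "X \<in> fps_grading L a" "Y \<in> fps_grading L b" "U \<in> fps_grading L c"
    and V: "V \<in> fps_grading L d" and W: "W \<in> fps_grading L e"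
  shows "trt (\<alpha>t (\<alpha>t X)) (\<alpha>t (\<alpha>t Y)) (trt U V W) =
    trt (trt X Y U) (\<alpha>t (\<alpha>t V)) (\<alpha>t (\<alpha>t W))
    + sgn_pow (c * (a + b)) (trt (\<alpha>t (\<alpha>t U)) (trt X Y V) (\<alpha>t (\<alpha>t W)))
    + sgn_pow ((c + d) * (a + b)) (trt (\<alpha>t (\<alpha>t U)) (\<alpha>t (\<alpha>t V)) (trt X Y W))"
proof -
  let ?S = "\<lambda>V W X Y U. trt (\<alpha>t (\<alpha>t X)) (\<alpha>t (\<alpha>t Y)) (trt U V W) -
    (trt (trt X Y U) (\<alpha>t (\<alpha>t V)) (\<alpha>t (\<alpha>t W))
    + sgn_pow (c * (a + b)) (trt (\<alpha>t (\<alpha>t U)) (trt X Y V) (\<alpha>t (\<alpha>t W)))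
    + sgn_pow ((c + d) * (a + b)) (trt (\<alpha>t (\<alpha>t U)) (\<alpha>t (\<alpha>t V)) (trt X Y W)))"
  have "?S V W X Y U = 0"
    using _ _ _ _ assms(1-3)
  proof (rule t_trilinear_vanish[of "?S V W"])
    fix x y u assume xyu: "x \<in> L a" "y \<in> L b" "u \<in> L c"
    show "?S V W (fps_const x) (fps_const y) (fps_const u) = 0"
    proof (rule t_linear_vanish_grading[where T = "\<lambda>V. ?S V W _ _ _", OF _ _ V])
      fix v assume v: "v \<in> L d"
      show "?S (fps_const v) W (fps_const x) (fps_const y) (fps_const u) = 0"
      proof (rule t_linear_vanish_grading[where T = "\<lambda>W. ?S _ W _ _ _", OF _ _ W])
        fix w assume "w \<in> L e"
        then show "?S (fps_const v) (fps_const w) (fps_const x) (fps_const y) (fps_const u) = 0"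
          using tr_tr[of x a y b u c v d w e] xyu v
          by (simp add: null_extension_const sgn_pow_const)
      qed (intro t_linear_intros)
    qed (intro t_linear_intros)
  qed (intro t_linear_intros)+
  then show ?thesis
    by simp
qed

end


section \<open>The defect of a formal gauge transformation\<close>

text \<open>
  The failure of \<open>\<phi>\<close> to be a morphism from the deformed to the undeformed operations.
\<close>

definition defect2 where
  "defect2 br f \<phi> X Y =
    fps_ext1 \<phi> (fps_ext2 f X Y) - fps_ext2 (const_series br) (fps_ext1 \<phi> X) (fps_ext1 \<phi> Y)"

definition defect3 where
  "defect3 tr g \<phi> X Y Z = fps_ext1 \<phi> (fps_ext3 g X Y Z)
    - fps_ext3 (const_series tr) (fps_ext1 \<phi> X) (fps_ext1 \<phi> Y) (fps_ext1 \<phi> Z)"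

text \<open>
  Only constant arguments are tested; for them the coefficient of order \<open>k\<close> is a finite expression
  in the coefficients of \<open>f\<close>, \<open>g\<close> and \<open>\<phi>\<close> up to order \<open>k\<close>. Lemmas \<open>D2_nth\<close> and \<open>D3_nth\<close> extend the
  vanishing to all series.
\<close>

definition trivializes_below where
  "trivializes_below br tr f g \<phi> n \<longleftrightarrow>
    (\<forall>k<n. \<forall>x y. defect2 br f \<phi> (fps_const x) (fps_const y) $ k = 0) \<and>
    (\<forall>k<n. \<forall>x y z. defect3 tr g \<phi> (fps_const x) (fps_const y) (fps_const z) $ k = 0)"

locale gauge_transformation = hom_lie_yamaguti_superalgebra scale L br tr \<alpha>
  for scale :: "'r::comm_ring_1 \<Rightarrow> 'v::ab_group_add \<Rightarrow> 'v" (infixr \<open>*s\<close> 75)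
    and L br tr \<alpha> +
  fixes f :: "nat \<Rightarrow> 'v \<Rightarrow> 'v \<Rightarrow> 'v"
    and g :: "nat \<Rightarrow> 'v \<Rightarrow> 'v \<Rightarrow> 'v \<Rightarrow> 'v"
    and \<phi> :: "nat \<Rightarrow> 'v \<Rightarrow> 'v"
  assumes deformation: "formal_deformation scale L br tr \<alpha> f g"
    and gauge_C1: "\<phi> i \<in> C1 scale L \<alpha>"
    and gauge_0: "\<phi> 0 = id"
begin

sublocale ft: hom_lie_yamaguti_superalgebra "fps_scale scale" "fps_grading L"
  "fps_ext2 f" "fps_ext3 g" \<alpha>t
  using deformation by (simp add: formal_deformation_def)

abbreviation "ft \<equiv> fps_ext2 f"
abbreviation "gt \<equiv> fps_ext3 g"
abbreviation "\<Phi> \<equiv> fps_ext1 \<phi>"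
abbreviation "D2 \<equiv> defect2 br f \<phi>"
abbreviation "D3 \<equiv> defect3 tr g \<phi>"

lemma f_0: "f 0 = br" and g_0: "g 0 = tr"
  and even_f: "even_bilinear scale L (f i)" and even_g: "even_trilinear scale L (g i)"
  using deformation by (simp_all add: formal_deformation_def)

lemma even_gauge: "even_linear scale L (\<phi> i)" and gauge_\<alpha>: "\<phi> i (\<alpha> x) = \<alpha> (\<phi> i x)"
  using gauge_C1[of i] by (simp_all add: C1_def)

lemmas gauge_additive = even_linear_additive[OF even_gauge]
lemmas f_additive = even_bilinear_additive[OF even_f]
lemmas g_additive = even_trilinear_additive[OF even_g]

lemma t_linear_gauge: "t_linear \<Phi>"
  by (intro t_linear_ext1 gauge_additive)

lemma t_linear_ft: "t_linear (\<lambda>X. ft X Y)" "t_linear (ft X)"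
  by (intro t_linear_ext2 f_additive)+

lemma t_linear_gt: "t_linear (\<lambda>X. gt X Y Z)" "t_linear (\<lambda>Y. gt X Y Z)" "t_linear (gt X Y)"
  by (intro t_linear_ext3 g_additive)+

lemma t_linear_D2: "t_linear (\<lambda>X. D2 X Y)" "t_linear (D2 X)"
  unfolding defect2_def
  by (intro t_linear_intros t_linear_compose[OF t_linear_gauge] t_linear_ft t_linear_gauge)+

lemma t_linear_D3: "t_linear (\<lambda>X. D3 X Y Z)" "t_linear (\<lambda>Y. D3 X Y Z)" "t_linear (D3 X Y)"
  unfolding defect3_def
  by (intro t_linear_intros t_linear_compose[OF t_linear_gauge] t_linear_gt t_linear_gauge)+

lemma gauge_const_nth: "\<Phi> (fps_const x) $ i = \<phi> i x"
  by (rule fps_ext1_const[OF gauge_additive])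

lemma gauge_\<alpha>t: "\<Phi> (\<alpha>t X) = \<alpha>t (\<Phi> X)"
  by (rule fps_ext)
    (simp add: fps_ext1_const_series fps_ext1_def[of \<phi>] gauge_\<alpha>
      additive.sum[OF even_linear_additive[OF even_\<alpha>]])

lemma gauge_const_in_grading: "x \<in> L a \<Longrightarrow> \<Phi> (fps_const x) \<in> fps_grading L a"
  using even_gauge by (simp add: fps_grading_def gauge_const_nth even_linear_def)

lemma gauge_ft: "\<Phi> (ft X Y) = brt (\<Phi> X) (\<Phi> Y) + D2 X Y"
  and gauge_gt: "\<Phi> (gt X Y Z) = trt (\<Phi> X) (\<Phi> Y) (\<Phi> Z) + D3 X Y Z"
  by (simp_all add: defect2_def defect3_def)

text \<open>
  A factor of order \<open>n\<close> reduces each of the other factors to its constant coefficient.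
\<close>

lemma brt_order:
  assumes "\<And>k. k < n \<Longrightarrow> P $ k = 0" "k \<le> n"
  shows "brt P Y $ k = (if k = n then br (P $ n) (Y $ 0) else 0)"
    "brt Y P $ k = (if k = n then br (Y $ 0) (P $ n) else 0)"
  using t_linear_order[OF t_linear_brt(1) assms] t_linear_order[OF t_linear_brt(2) assms]
  by (simp_all add: fps_ext_nth_0 const_series_def)

lemma trt_order:
  assumes "\<And>k. k < n \<Longrightarrow> P $ k = 0" "k \<le> n"
  shows "trt P Y Z $ k = (if k = n then tr (P $ n) (Y $ 0) (Z $ 0) else 0)"
    "trt Y P Z $ k = (if k = n then tr (Y $ 0) (P $ n) (Z $ 0) else 0)"
    "trt Y Z P $ k = (if k = n then tr (Y $ 0) (Z $ 0) (P $ n) else 0)"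
  using t_linear_order[OF t_linear_trt(1) assms] t_linear_order[OF t_linear_trt(2) assms]
    t_linear_order[OF t_linear_trt(3) assms]
  by (simp_all add: fps_ext_nth_0 const_series_def)

text \<open>
  The coefficients of order \<open>n\<close> of the defects; below they are the leading ones and form the
  obstruction cocycle.
\<close>

definition "lead2 n x y = D2 (fps_const x) (fps_const y) $ n"
definition "lead3 n x y z = D3 (fps_const x) (fps_const y) (fps_const z) $ n"

text \<open>
  The explicit formulas exhibit the obstruction as built from even multilinear maps, hence as even
  and multilinear itself.
\<close>

lemma lead2_eq:
  "lead2 n x y = (\<Sum>i\<le>n. \<phi> i (f (n - i) x y)) - (\<Sum>j\<le>n. br (\<phi> j x) (\<phi> (n - j) y))"
proof -
  have "\<Phi> (ft (fps_const x) (fps_const y)) $ n = (\<Sum>i\<le>n. \<phi> i (f (n - i) x y))"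
    by (simp add: fps_ext1_def fps_ext2_const[OF f_additive])
  then show ?thesis
    by (simp add: lead2_def defect2_def fps_ext2_const_series gauge_const_nth)
qed

lemma lead3_eq:
  "lead3 n x y z = (\<Sum>i\<le>n. \<phi> i (g (n - i) x y z)) -
    (\<Sum>j\<le>n. \<Sum>k\<le>n - j. tr (\<phi> j x) (\<phi> k y) (\<phi> (n - j - k) z))"
proof -
  have "\<Phi> (gt (fps_const x) (fps_const y) (fps_const z)) $ n = (\<Sum>i\<le>n. \<phi> i (g (n - i) x y z))"
    by (simp add: fps_ext1_def fps_ext3_const[OF g_additive])
  then show ?thesis
    by (simp add: lead3_def defect3_def fps_ext3_const_series gauge_const_nth)
qed

lemma even_lead2: "even_bilinear scale L (lead2 n)"
  unfolding lead2_eq[abs_def]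
  by (intro even_bilinear_diff even_bilinear_sum even_bilinear_compose_linear[OF even_gauge]
      even_bilinear_substitute[OF even_br] even_f even_gauge)

lemma even_lead3: "even_trilinear scale L (lead3 n)"
  unfolding lead3_eq[abs_def]
  by (intro even_trilinear_diff even_trilinear_sum even_trilinear_compose_linear[OF even_gauge]
      even_trilinear_substitute[OF even_tr] even_g even_gauge)

lemma D2_nth:
  assumes "trivializes_below br tr f g \<phi> n"
  shows "k < n \<Longrightarrow> D2 X Y $ k = 0" and "D2 X Y $ n = lead2 n (X $ 0) (Y $ 0)"
proof -
  have const: "D2 (fps_const x) (fps_const y) $ k = 0" if "k < n" for x y k
    using assms that by (simp add: trivializes_below_def)
  have left: "D2 (fps_const x) Y $ k = 0" if "k < n" for x k
    by (rule t_linear_vanish_below[OF t_linear_D2(2), of UNIV n]) (use const that in auto)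
  show "D2 X Y $ k = 0" if "k < n"
    by (rule t_linear_vanish_below[OF t_linear_D2(1), of UNIV n]) (use left that in auto)
  have "D2 X Y $ n = D2 (fps_const (X $ 0)) Y $ n"
    by (rule t_linear_leading_nth[OF t_linear_D2(1) left])
  also have "\<dots> = lead2 n (X $ 0) (Y $ 0)"
    unfolding lead2_def by (rule t_linear_leading_nth[OF t_linear_D2(2) const])
  finally show "D2 X Y $ n = lead2 n (X $ 0) (Y $ 0)" .
qed

lemma D3_nth:
  assumes "trivializes_below br tr f g \<phi> n"
  shows "k < n \<Longrightarrow> D3 X Y Z $ k = 0" and "D3 X Y Z $ n = lead3 n (X $ 0) (Y $ 0) (Z $ 0)"
proof -
  have const: "D3 (fps_const x) (fps_const y) (fps_const z) $ k = 0" if "k < n" for x y z k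
    using assms that by (simp add: trivializes_below_def)
  have left2: "D3 (fps_const x) (fps_const y) Z $ k = 0" if "k < n" for x y k
    by (rule t_linear_vanish_below[OF t_linear_D3(3), of UNIV n]) (use const that in auto)
  have left: "D3 (fps_const x) Y Z $ k = 0" if "k < n" for x k
    by (rule t_linear_vanish_below[OF t_linear_D3(2), of UNIV n]) (use left2 that in auto)
  show "D3 X Y Z $ k = 0" if "k < n"
    by (rule t_linear_vanish_below[OF t_linear_D3(1), of UNIV n]) (use left that in auto)
  have "D3 X Y Z $ n = D3 (fps_const (X $ 0)) Y Z $ n"
    by (rule t_linear_leading_nth[OF t_linear_D3(1) left])
  also have "\<dots> = D3 (fps_const (X $ 0)) (fps_const (Y $ 0)) Z $ n"
    by (rule t_linear_leading_nth[OF t_linear_D3(2) left2])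
  also have "\<dots> = lead3 n (X $ 0) (Y $ 0) (Z $ 0)"
    unfolding lead3_def by (rule t_linear_leading_nth[OF t_linear_D3(3) const])
  finally show "D3 X Y Z $ n = lead3 n (X $ 0) (Y $ 0) (Z $ 0)" .
qed

lemmas linear_simps =
  t_linear_add[OF t_linear_gauge] t_linear_minus[OF t_linear_gauge]
  t_linear_diff[OF t_linear_\<alpha>t] t_linear_apply_sgn_pow[OF t_linear_gauge]
  t_linear_add[OF t_linear_brt(1)] t_linear_add[OF t_linear_brt(2)]
  t_linear_add[OF t_linear_trt(1)] t_linear_add[OF t_linear_trt(2)] t_linear_add[OF t_linear_trt(3)]

text \<open>
  Each cocycle identity is the coefficient of order \<open>n\<close> of an identity between defects. That identity
  arises by applying \<open>\<Phi>\<close> to an axiom of the deformation and subtracting the same axiom for the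
  undeformed operations at \<open>\<Phi> x, \<Phi> y, \<dots>\<close>.
\<close>

lemma lead_in_Z23:
  assumes below: "trivializes_below br tr f g \<phi> n"
  shows "(lead2 n, lead3 n) \<in> Z23 scale L br tr \<alpha>"
proof -
  \<comment> \<open>This rule would turn the exponents \<open>a * b\<close> of the signs into case distinctions.\<close>
  note [simp del] = mult_bit_eq_and
  note nth = D2_nth[OF below] D3_nth[OF below]
  note lead_products = brt_order(1)[of n "D2 _ _"] brt_order[of n "D3 _ _ _"]
     trt_order(1)[of n "D2 _ _"] trt_order(3)[of n "D2 _ _"] trt_order[of n "D3 _ _ _"]
  note coeff = nth lead_products sgn_pow_nth gauge_0 fps_ext1_const_series fps_ext_nth_0 f_0 g_0
    const_series_def
  note expand = gauge_ft gauge_gt gauge_\<alpha>t linear_simps sgn_pow_add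
  have skew2: "lead2 n x y = - sgn_pow (a * b) (lead2 n y x)" if "x \<in> L a" "y \<in> L b" for x y a b
  proof -
    let ?x = "fps_const x" and ?y = "fps_const y"
    have "D2 ?x ?y = - sgn_pow (a * b) (D2 ?y ?x)"
      unfolding defect2_def
      using that ft.br_skew[of ?x a ?y b] null_br_skew[of "\<Phi> ?x" a "\<Phi> ?y" b]
      by (simp add: fps_const_in_grading gauge_const_in_grading linear_simps sgn_pow_diff)
    then show ?thesis
      by (simp add: lead2_def sgn_pow_nth)
  qed
  have \<alpha>2: "\<alpha> (lead2 n x y) = lead2 n (\<alpha> x) (\<alpha> y)" if "x \<in> L a" "y \<in> L b" for x y a b
  proof -
    let ?x = "fps_const x" and ?y = "fps_const y"
    have "\<alpha>t (D2 ?x ?y) = D2 (\<alpha>t ?x) (\<alpha>t ?y)"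
      unfolding defect2_def
      using that ft.\<alpha>_br[of ?x a ?y b] null_\<alpha>_br[of "\<Phi> ?x" a "\<Phi> ?y" b]
      by (simp add: fps_const_in_grading gauge_const_in_grading linear_simps gauge_\<alpha>t[symmetric])
    then show ?thesis
      by (metis fps_ext1_const_series lead2_def null_extension_const(1))
  qed
  have skew3: "lead3 n x y z = - sgn_pow (a * b) (lead3 n y x z)"
    if "x \<in> L a" "y \<in> L b" "z \<in> L c" for x y z a b c
  proof -
    let ?x = "fps_const x" and ?y = "fps_const y" and ?z = "fps_const z"
    have "D3 ?x ?y ?z = - sgn_pow (a * b) (D3 ?y ?x ?z)"
      unfolding defect3_def
      using that ft.tr_skew[of ?x a ?y b ?z c] null_tr_skew[of "\<Phi> ?x" a "\<Phi> ?y" b "\<Phi> ?z" c]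
      by (simp add: fps_const_in_grading gauge_const_in_grading linear_simps sgn_pow_diff)
    then show ?thesis
      by (simp add: lead3_def sgn_pow_nth)
  qed
  have \<alpha>3: "\<alpha> (lead3 n x y z) = lead3 n (\<alpha> x) (\<alpha> y) (\<alpha> z)"
    if "x \<in> L a" "y \<in> L b" "z \<in> L c" for x y z a b c
  proof -
    let ?x = "fps_const x" and ?y = "fps_const y" and ?z = "fps_const z"
    have "\<alpha>t (D3 ?x ?y ?z) = D3 (\<alpha>t ?x) (\<alpha>t ?y) (\<alpha>t ?z)"
      unfolding defect3_def
      using that ft.\<alpha>_tr[of ?x a ?y b ?z c] null_\<alpha>_tr[of "\<Phi> ?x" a "\<Phi> ?y" b "\<Phi> ?z" c]
      by (simp add: fps_const_in_grading gauge_const_in_grading linear_simps gauge_\<alpha>t[symmetric])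
    then show ?thesis
      by (metis fps_ext1_const_series lead3_def null_extension_const(1))
  qed
  have cyclic2: "cyclic_sum (\<lambda>x y z. br (lead2 n x y) (\<alpha> z) + lead2 n (br x y) (\<alpha> z) + lead3 n x y z)
      a b c x y z = 0" if "x \<in> L a" "y \<in> L b" "z \<in> L c" for x y z a b c
  proof -
    let ?x = "fps_const x" and ?y = "fps_const y" and ?z = "fps_const z"
    have "0 = \<Phi> (cyclic_sum (\<lambda>X Y Z. ft (ft X Y) (\<alpha>t Z) + gt X Y Z) a b c ?x ?y ?z)"
      using that by (simp add: ft.cyclic_br fps_const_in_grading t_linear_zero[OF t_linear_gauge])
    also have "\<dots> = cyclic_sum (\<lambda>X Y Z. brt (brt X Y) (\<alpha>t Z) + trt X Y Z) a b c (\<Phi> ?x) (\<Phi> ?y) (\<Phi> ?z)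
        + cyclic_sum (\<lambda>X Y Z. brt (D2 X Y) (\<alpha>t (\<Phi> Z)) + D2 (ft X Y) (\<alpha>t Z) + D3 X Y Z) a b c ?x ?y ?z"
      by (simp add: cyclic_sum_def expand)
    finally have "0 = cyclic_sum (\<lambda>X Y Z. brt (D2 X Y) (\<alpha>t (\<Phi> Z)) + D2 (ft X Y) (\<alpha>t Z) + D3 X Y Z)
        a b c ?x ?y ?z $ n"
      using that by (simp add: null_cyclic_br gauge_const_in_grading)
    then show ?thesis
      by (simp add: cyclic_sum_def coeff)
  qed
  have cyclic3: "cyclic_sum (\<lambda>x y z. tr (lead2 n x y) (\<alpha> z) (\<alpha> u) + lead3 n (br x y) (\<alpha> z) (\<alpha> u))
      a b c x y z = 0" if "x \<in> L a" "y \<in> L b" "z \<in> L c" "u \<in> L d" for x y z u a b c d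
  proof -
    let ?x = "fps_const x" and ?y = "fps_const y" and ?z = "fps_const z" and ?u = "fps_const u"
    have "0 = \<Phi> (cyclic_sum (\<lambda>X Y Z. gt (ft X Y) (\<alpha>t Z) (\<alpha>t ?u)) a b c ?x ?y ?z)"
      using that ft.cyclic_tr[of ?x a ?y b ?z c ?u d]
      by (simp add: fps_const_in_grading t_linear_zero[OF t_linear_gauge])
    also have "\<dots> = cyclic_sum (\<lambda>X Y Z. trt (brt X Y) (\<alpha>t Z) (\<alpha>t (\<Phi> ?u))) a b c (\<Phi> ?x) (\<Phi> ?y) (\<Phi> ?z)
        + cyclic_sum (\<lambda>X Y Z. trt (D2 X Y) (\<alpha>t (\<Phi> Z)) (\<alpha>t (\<Phi> ?u)) + D3 (ft X Y) (\<alpha>t Z) (\<alpha>t ?u))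
            a b c ?x ?y ?z"
      by (simp add: cyclic_sum_def expand)
    finally have "0 = cyclic_sum (\<lambda>X Y Z. trt (D2 X Y) (\<alpha>t (\<Phi> Z)) (\<alpha>t (\<Phi> ?u)) + D3 (ft X Y) (\<alpha>t Z) (\<alpha>t ?u))
            a b c ?x ?y ?z $ n"
      using that null_cyclic_tr[of "\<Phi> ?x" a "\<Phi> ?y" b "\<Phi> ?z" c "\<Phi> ?u" d]
      by (simp add: gauge_const_in_grading)
    then show ?thesis
      by (simp add: cyclic_sum_def coeff)
  qed
  have tr_br': "tr (\<alpha> x) (\<alpha> y) (lead2 n u v) + lead3 n (\<alpha> x) (\<alpha> y) (br u v) =
        br (lead3 n x y u) (\<alpha> (\<alpha> v)) + lead2 n (tr x y u) (\<alpha> (\<alpha> v))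
        + sgn_pow (c * (a + b)) (br (\<alpha> (\<alpha> u)) (lead3 n x y v) + lead2 n (\<alpha> (\<alpha> u)) (tr x y v))"
    if "x \<in> L a" "y \<in> L b" "u \<in> L c" "v \<in> L d" for x y u v a b c d
  proof -
    let ?x = "fps_const x" and ?y = "fps_const y" and ?u = "fps_const u" and ?v = "fps_const v"
    have "\<Phi> (gt (\<alpha>t ?x) (\<alpha>t ?y) (ft ?u ?v)) = \<Phi> (ft (gt ?x ?y ?u) (\<alpha>t (\<alpha>t ?v))
        + sgn_pow (c * (a + b)) (ft (\<alpha>t (\<alpha>t ?u)) (gt ?x ?y ?v)))"
      using that ft.tr_br[of ?x a ?y b ?u c ?v d] by (simp add: fps_const_in_grading)
    then have "trt (\<alpha>t (\<Phi> ?x)) (\<alpha>t (\<Phi> ?y)) (D2 ?u ?v) + D3 (\<alpha>t ?x) (\<alpha>t ?y) (ft ?u ?v) =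
        brt (D3 ?x ?y ?u) (\<alpha>t (\<alpha>t (\<Phi> ?v))) + D2 (gt ?x ?y ?u) (\<alpha>t (\<alpha>t ?v))
        + sgn_pow (c * (a + b)) (brt (\<alpha>t (\<alpha>t (\<Phi> ?u))) (D3 ?x ?y ?v) + D2 (\<alpha>t (\<alpha>t ?u)) (gt ?x ?y ?v))"
      using that null_tr_br[of "\<Phi> ?x" a "\<Phi> ?y" b "\<Phi> ?u" c "\<Phi> ?v" d]
      by (simp add: expand gauge_const_in_grading)
    from arg_cong[OF this, of "\<lambda>X. X $ n"] show ?thesis
      by (simp add: coeff)
  qed
  have tr_tr': "tr (\<alpha> (\<alpha> x)) (\<alpha> (\<alpha> y)) (lead3 n u v w) + lead3 n (\<alpha> (\<alpha> x)) (\<alpha> (\<alpha> y)) (tr u v w) =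
        tr (lead3 n x y u) (\<alpha> (\<alpha> v)) (\<alpha> (\<alpha> w)) + lead3 n (tr x y u) (\<alpha> (\<alpha> v)) (\<alpha> (\<alpha> w))
        + sgn_pow (c * (a + b))
            (tr (\<alpha> (\<alpha> u)) (lead3 n x y v) (\<alpha> (\<alpha> w)) + lead3 n (\<alpha> (\<alpha> u)) (tr x y v) (\<alpha> (\<alpha> w)))
        + sgn_pow ((c + d) * (a + b))
            (tr (\<alpha> (\<alpha> u)) (\<alpha> (\<alpha> v)) (lead3 n x y w) + lead3 n (\<alpha> (\<alpha> u)) (\<alpha> (\<alpha> v)) (tr x y w))"
    if "x \<in> L a" "y \<in> L b" "u \<in> L c" "v \<in> L d" "w \<in> L e" for x y u v w a b c d e
  proof -
    let ?x = "fps_const x" and ?y = "fps_const y" and ?u = "fps_const u" and ?v = "fps_const v"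
      and ?w = "fps_const w"
    have "\<Phi> (gt (\<alpha>t (\<alpha>t ?x)) (\<alpha>t (\<alpha>t ?y)) (gt ?u ?v ?w)) = \<Phi> (gt (gt ?x ?y ?u) (\<alpha>t (\<alpha>t ?v)) (\<alpha>t (\<alpha>t ?w))
        + sgn_pow (c * (a + b)) (gt (\<alpha>t (\<alpha>t ?u)) (gt ?x ?y ?v) (\<alpha>t (\<alpha>t ?w)))
        + sgn_pow ((c + d) * (a + b)) (gt (\<alpha>t (\<alpha>t ?u)) (\<alpha>t (\<alpha>t ?v)) (gt ?x ?y ?w)))"
      using that ft.tr_tr[of ?x a ?y b ?u c ?v d ?w e] by (simp add: fps_const_in_grading)
    then have "trt (\<alpha>t (\<alpha>t (\<Phi> ?x))) (\<alpha>t (\<alpha>t (\<Phi> ?y))) (D3 ?u ?v ?w)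
          + D3 (\<alpha>t (\<alpha>t ?x)) (\<alpha>t (\<alpha>t ?y)) (gt ?u ?v ?w) =
        trt (D3 ?x ?y ?u) (\<alpha>t (\<alpha>t (\<Phi> ?v))) (\<alpha>t (\<alpha>t (\<Phi> ?w)))
          + D3 (gt ?x ?y ?u) (\<alpha>t (\<alpha>t ?v)) (\<alpha>t (\<alpha>t ?w))
        + sgn_pow (c * (a + b)) (trt (\<alpha>t (\<alpha>t (\<Phi> ?u))) (D3 ?x ?y ?v) (\<alpha>t (\<alpha>t (\<Phi> ?w)))
          + D3 (\<alpha>t (\<alpha>t ?u)) (gt ?x ?y ?v) (\<alpha>t (\<alpha>t ?w)))
        + sgn_pow ((c + d) * (a + b)) (trt (\<alpha>t (\<alpha>t (\<Phi> ?u))) (\<alpha>t (\<alpha>t (\<Phi> ?v))) (D3 ?x ?y ?w)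
          + D3 (\<alpha>t (\<alpha>t ?u)) (\<alpha>t (\<alpha>t ?v)) (gt ?x ?y ?w))"
      using that null_tr_tr[of "\<Phi> ?x" a "\<Phi> ?y" b "\<Phi> ?u" c "\<Phi> ?v" d "\<Phi> ?w" e]
      by (simp add: expand gauge_const_in_grading)
    from arg_cong[OF this, of "\<lambda>X. X $ n"] show ?thesis
      by (simp add: coeff)
  qed
  show ?thesis
    unfolding Z23_def C2_def C3_def mem_Collect_eq prod.case
    by (intro conjI allI ballI even_lead2 even_lead3; fact)
qed

text \<open>
  Adding \<open>H = h t\<^sup>n\<close> to \<open>\<Phi>\<close> changes \<open>D2\<close> by \<open>H(f(x, y)) - [H x, \<Phi> y] - [\<Phi> x, H y]\<close> up to a term
  with two factors \<open>H\<close>. In order \<open>n\<close> this is minus the coboundary of \<open>h\<close>; the product of two factors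
  \<open>H\<close> has order at least \<open>2 n\<close>, which exceeds \<open>n\<close> because \<open>n > 0\<close>. The same holds for \<open>D3\<close>.
\<close>

lemma correction:
  assumes n: "0 < n" and below: "trivializes_below br tr f g \<phi> n" and h: "h \<in> C1 scale L \<alpha>"
    and lead: "lead2 n = \<delta>\<^sub>I br h" "lead3 n = \<delta>\<^sub>I\<^sub>I tr h"
  shows "trivializes_below br tr f g (\<phi>(n := \<lambda>x. \<phi> n x + h x)) (Suc n)"
proof -
  define \<psi> where "\<psi> = \<phi>(n := \<lambda>x. \<phi> n x + h x)"
  define H where "H = fps_ext1 (\<lambda>i. if i = n then h else 0)"
  have h_0: "h 0 = 0"
    using h even_linear_additive[of h] by (simp add: C1_def additive.zero)
  have H_nth: "H X $ k = (if k = n then h (X $ 0) else 0)" if "k \<le> n" for X k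
  proof -
    have "(\<Sum>i\<le>k. (if i = n then h else 0) (X $ (k - i))) = (\<Sum>i\<le>k. if i = n then h (X $ 0) else 0)"
      using that by (intro sum.cong) auto
    then show ?thesis
      using that by (simp add: H_def fps_ext1_def)
  qed
  have gauge': "fps_ext1 \<psi> X = \<Phi> X + H X" for X
    by (rule fps_ext) (auto simp: \<psi>_def H_def fps_ext1_def sum.distrib[symmetric] intro!: sum.cong)
  have order: "H X $ k = 0" if "k < n" for X k
    using that by (simp add: H_nth)
  note H_products = brt_order[OF order] trt_order[OF order]
  have "defect2 br f \<psi> (fps_const x) (fps_const y) $ k = 0"
    if "k \<le> n" for x y k
  proof -
    let ?x = "fps_const x" and ?y = "fps_const y"
    have "defect2 br f \<psi> ?x ?y = D2 ?x ?y + H (ft ?x ?y)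
        - brt (H ?x) (\<Phi> ?y) - brt (\<Phi> ?x) (H ?y) - brt (H ?x) (H ?y)"
      by (simp add: defect2_def gauge' linear_simps algebra_simps)
    then show ?thesis
      using that n D2_nth[OF below]
      by (auto simp: H_products H_nth fps_ext_nth_0 f_0 gauge_0 lead(1) \<delta>\<^sub>I_def
          additive.zero[OF even_bilinear_additive(2)[OF even_br]]
          additive.zero[OF even_bilinear_additive(1)[OF even_br]])
  qed
  moreover have "defect3 tr g \<psi> (fps_const x) (fps_const y) (fps_const z) $ k = 0"
    if "k \<le> n" for x y z k
  proof -
    let ?x = "fps_const x" and ?y = "fps_const y" and ?z = "fps_const z"
    have "defect3 tr g \<psi> ?x ?y ?z = D3 ?x ?y ?z + H (gt ?x ?y ?z)
        - trt (H ?x) (\<Phi> ?y) (\<Phi> ?z) - trt (\<Phi> ?x) (H ?y) (\<Phi> ?z) - trt (\<Phi> ?x) (\<Phi> ?y) (H ?z)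
        - trt (H ?x) (H ?y) (\<Phi> ?z) - trt (H ?x) (\<Phi> ?y) (H ?z) - trt (\<Phi> ?x) (H ?y) (H ?z)
        - trt (H ?x) (H ?y) (H ?z)"
      by (simp add: defect3_def gauge' linear_simps algebra_simps)
    then show ?thesis
      using that n D3_nth[OF below]
      by (auto simp: H_products H_nth fps_ext_nth_0 g_0 gauge_0 lead(2) \<delta>\<^sub>I\<^sub>I_def
          additive.zero[OF even_trilinear_additive(1)[OF even_tr]]
          additive.zero[OF even_trilinear_additive(2)[OF even_tr]]
          additive.zero[OF even_trilinear_additive(3)[OF even_tr]])
  qed
  ultimately show ?thesis
    by (simp add: trivializes_below_def less_Suc_eq_le \<psi>_def[symmetric])
qed

lemma module_hom_gauge: "module_hom (fps_scale scale) (fps_scale scale) \<Phi>"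
  unfolding module_hom_iff
proof (intro conjI allI ft.module_axioms t_linear_add[OF t_linear_gauge])
  fix c X
  show "\<Phi> (fps_scale scale c X) = fps_scale scale c (\<Phi> X)"
  proof (rule fps_ext)
    fix n
    have "\<Phi> (fps_scale scale c X) $ n = (\<Sum>i\<le>n. \<Sum>j\<le>n - i. (c $ j) *s \<phi> i (X $ (n - i - j)))"
      using even_gauge
      by (simp add: fps_ext1_def fps_scale_def additive.sum[OF gauge_additive] even_defs)
    also have "\<dots> = fps_scale scale c (\<Phi> X) $ n"
      by (subst sum_simplex_swap) (simp add: fps_ext1_def fps_scale_def scale_sum_right add_ac)
    finally show "\<Phi> (fps_scale scale c X) $ n = fps_scale scale c (\<Phi> X) $ n" .
  qed
qed

lemma equivalent_to_null:
  assumes "\<And>n. trivializes_below br tr f g \<phi> n"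
  shows "equivalent_deformations scale L \<alpha> f g (const_series br) (const_series tr)"
proof -
  have "D2 X Y = 0" "D3 X Y Z = 0" for X Y Z
    using D2_nth(1)[OF assms[of "Suc _"] lessI] D3_nth(1)[OF assms[of "Suc _"] lessI]
    by (auto simp: fps_eq_iff)
  then show ?thesis
    unfolding equivalent_deformations_def
    by (intro exI[of _ \<phi>])
      (simp add: even_gauge gauge_0 module_hom_gauge bij_unipotent_ext1[OF gauge_additive]
        gauge_\<alpha>t fun_eq_iff gauge_ft gauge_gt)
qed

lemma correction_exists:
  assumes H: "H23 scale L br tr \<alpha> = {B23 scale L br tr \<alpha>}"
    and n: "0 < n" and below: "trivializes_below br tr f g \<phi> n"
  shows "\<exists>\<psi>. (\<forall>i. \<psi> i \<in> C1 scale L \<alpha>) \<and> (\<forall>i<n. \<psi> i = \<phi> i) \<and> trivializes_below br tr f g \<psi> (Suc n)"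
proof -
  have "even_linear scale L 0" "additive \<alpha>"
    using even_linear_zero even_linear_additive[OF even_\<alpha>] by auto
  then have "(0 :: 'v \<Rightarrow> 'v) \<in> C1 scale L \<alpha>"
    by (simp add: C1_def additive.zero)
  then have "(\<delta>\<^sub>I br 0, \<delta>\<^sub>I\<^sub>I tr 0) \<in> B23 scale L br tr \<alpha>"
    by (auto simp: B23_def)
  moreover have "(\<delta>\<^sub>I br 0, \<delta>\<^sub>I\<^sub>I tr 0) = 0"
    by (simp add: \<delta>\<^sub>I_def \<delta>\<^sub>I\<^sub>I_def fun_eq_iff zero_prod_def
        additive.zero[OF even_bilinear_additive(1)[OF even_br]]
        additive.zero[OF even_bilinear_additive(2)[OF even_br]]
        additive.zero[OF even_trilinear_additive(1)[OF even_tr]]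
        additive.zero[OF even_trilinear_additive(2)[OF even_tr]]
        additive.zero[OF even_trilinear_additive(3)[OF even_tr]])
  \<comment> \<open>The coset of the obstruction contains it, and it is equal to the only coset, \<open>B23\<close>.\<close>
  ultimately have "(lead2 n, lead3 n) \<in> (\<lambda>q. (lead2 n, lead3 n) + q) ` B23 scale L br tr \<alpha>"
    by (metis add.right_neutral imageI)
  also have "\<dots> = B23 scale L br tr \<alpha>"
    using imageI[OF lead_in_Z23[OF below]] H unfolding H23_def by (metis singletonD)
  finally obtain h where h: "h \<in> C1 scale L \<alpha>" "lead2 n = \<delta>\<^sub>I br h" "lead3 n = \<delta>\<^sub>I\<^sub>I tr h"
    by (auto simp: B23_def)
  have "(\<lambda>x. \<phi> n x + h x) \<in> C1 scale L \<alpha>"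
    using h(1) gauge_C1[of n] even_linear_add[of "\<phi> n" h] additive.add[OF \<open>additive \<alpha>\<close>]
    by (simp add: C1_def)
  then show ?thesis
    using correction[OF n below h] gauge_C1 n by (intro exI[of _ "\<phi>(n := \<lambda>x. \<phi> n x + h x)"]) auto
qed

end


section \<open>Rigidity\<close>

lemma trivializes_below_cong:
  assumes "\<And>i. i < n \<Longrightarrow> \<phi> i = \<psi> i"
  shows "trivializes_below br tr f g \<phi> n \<longleftrightarrow> trivializes_below br tr f g \<psi> n"
proof -
  have ext1: "fps_ext1 \<phi> X $ k = fps_ext1 \<psi> X $ k" if "k < n" for X k
    using assms that by (simp add: fps_ext1_def)
  have "defect2 br f \<phi> X Y $ k = defect2 br f \<psi> X Y $ k"
    "defect3 tr g \<phi> X Y Z $ k = defect3 tr g \<psi> X Y Z $ k" if "k < n" for X Y Z k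
    using that by (simp_all add: defect2_def defect3_def fps_ext2_const_series fps_ext3_const_series ext1)
  then show ?thesis
    by (simp add: trivializes_below_def)
qed

lemma (in hom_lie_yamaguti_superalgebra) rigid_if_H23_zero:
  assumes H: "H23 scale L br tr \<alpha> = {B23 scale L br tr \<alpha>}"
  shows "analytically_rigid scale L br tr \<alpha>"
  unfolding analytically_rigid_def
proof (intro allI impI)
  fix f g assume def: "formal_deformation scale L br tr \<alpha> f g"
  \<comment> \<open>The index is shifted by one: in order \<open>0\<close> the identity already has no defect, and the
    correction step needs positive order in order to keep \<open>\<phi> 0 = id\<close>.\<close>
  define P where "P n \<phi> \<longleftrightarrow>
    (\<forall>i. \<phi> i \<in> C1 scale L \<alpha>) \<and> \<phi> 0 = id \<and> trivializes_below br tr f g \<phi> (Suc n)" for n \<phi>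
  have gauge: "gauge_transformation scale L br tr \<alpha> f g \<phi>"
    if "\<And>i. \<phi> i \<in> C1 scale L \<alpha>" "\<phi> 0 = id" for \<phi>
    using that def by unfold_locales auto
  have "P 0 (const_series id)"
  proof -
    have "const_series id i \<in> C1 scale L \<alpha>" for i
      using additive.zero[OF even_linear_additive[OF even_\<alpha>]]
      by (simp add: C1_def even_const_series(1) even_linear_id) (simp add: const_series_def)
    moreover have "f 0 = br" "g 0 = tr"
      using def by (simp_all add: formal_deformation_def)
    ultimately show ?thesis
      by (simp add: P_def trivializes_below_def defect2_def defect3_def fps_ext_nth_0 const_series_def)
  qed
  moreover have "\<exists>\<psi>. P (Suc n) \<psi> \<and> (\<forall>i\<le>n. \<psi> i = \<phi> i)" if P: "P n \<phi>" for n \<phi>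
  proof -
    interpret gauge_transformation scale L br tr \<alpha> f g \<phi>
      using P gauge by (simp add: P_def)
    obtain \<psi> where "\<forall>i. \<psi> i \<in> C1 scale L \<alpha>" "\<forall>i\<le>n. \<psi> i = \<phi> i"
      "trivializes_below br tr f g \<psi> (Suc (Suc n))"
      using correction_exists[OF H, of "Suc n"] P by (auto simp: P_def less_Suc_eq_le)
    then show ?thesis
      using gauge_0 by (intro exI[of _ \<psi>]) (simp add: P_def)
  qed
  ultimately obtain \<Psi> where \<Psi>: "\<And>n. P n (\<Psi> n)" "\<And>n i. i \<le> n \<Longrightarrow> \<Psi> (Suc n) i = \<Psi> n i"
    using dependent_nat_choice[of P "\<lambda>n \<phi> \<psi>. \<forall>i\<le>n. \<psi> i = \<phi> i"] by metis
  have stable: "\<Psi> m i = \<Psi> i i" if "i \<le> m" for m i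
    using that by (induction m rule: dec_induct) (simp_all add: \<Psi>(2))
  \<comment> \<open>The coefficient of order \<open>n\<close> is final from stage \<open>n\<close> on, so the limit is the diagonal.\<close>
  interpret gauge_transformation scale L br tr \<alpha> f g "\<lambda>n. \<Psi> n n"
    by (rule gauge) (use \<Psi>(1) in \<open>auto simp: P_def\<close>)
  have "trivializes_below br tr f g (\<lambda>n. \<Psi> n n) n" for n
  proof -
    have "trivializes_below br tr f g (\<Psi> n) (Suc n)"
      using \<Psi>(1) by (simp add: P_def)
    then have "trivializes_below br tr f g (\<Psi> n) n"
      by (simp add: trivializes_below_def)
    then show ?thesis
      by (subst trivializes_below_cong[of n _ "\<Psi> n"]) (auto intro: stable[symmetric])
  qed
  then show "equivalent_deformations scale L \<alpha> f g (const_series br) (const_series tr)"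
    by (rule equivalent_to_null)
qed

theorem theorem5p5:
  fixes scale :: "'k::alg_closed_field \<Rightarrow> 'v::ab_group_add \<Rightarrow> 'v"
    and L :: "bit \<Rightarrow> 'v set"
    and br :: "'v \<Rightarrow> 'v \<Rightarrow> 'v"
    and tr :: "'v \<Rightarrow> 'v \<Rightarrow> 'v \<Rightarrow> 'v"
    and \<alpha> :: "'v \<Rightarrow> 'v"
  assumes "CHAR('k) \<noteq> 2" and "CHAR('k) \<noteq> 3"
    and "hom_lie_yamaguti_superalgebra scale L br tr \<alpha>"
    and "H23 scale L br tr \<alpha> = {B23 scale L br tr \<alpha>}"
  shows "analytically_rigid scale L br tr \<alpha>"
  using assms(3,4) by (rule hom_lie_yamaguti_superalgebra.rigid_if_H23_zero)

end
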